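(* If $\mathcal{M}$ is a type $\mathrm{II}_1$ factor, then there is a singular von Neumann subalgebra $\mathcal{N}$ of $\mathcal{M}$ such that $\mathcal{N}\neq\mathcal{M}$ and $\mathcal{N}\bar\otimes\mathcal{B}(l^2(\mathbb{N}))$ is regular in $\mathcal{M}\bar\otimes\mathcal{B}(l^2(\mathbb{N}))$.
   Context: $\bar\otimes$ denotes the von Neumann algebra tensor product, and von Neumann subalgebras contain the identity of the ambient algebra. For a von Neumann subalgebra $\mathcal{N}$ of a von Neumann algebra $\mathcal{M}$, the normalizer of $\mathcal{N}$ in $\mathcal{M}$ is $\mathfrak{N}_{\mathcal{M}}(\mathcal{N})=\{U\in\mathcal{M}: U \text{ unitary},\ U\mathcal{N}U^*=\mathcal{N}\}$, and $\mathfrak{N}_{\mathcal{M}}(\mathcal{N})''$ is the von Neumann algebra it generates. $\mathcal{N}$ is singular in $\mathcal{M}$ if $\mathfrak{N}_{\mathcal{M}}(\mathcal{N})\subseteq\mathcal{N}$ (equivalently $\mathfrak{N}_{\mathcal{M}}(\mathcal{N})''=\mathcal{N}$), and regular in $\mathcal{M}$ if $\mathfrak{N}_{\mathcal{M}}(\mathcal{N})''=\mathcal{M}$. *)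

theory Defs
  imports "HOL-Analysis.Analysis"
begin

section \<open>Complex Hilbert spaces\<close>

text \<open>
  The inner product is linear in the first argument. Positive definiteness and
  the link to the norm are inherited from \<^class>\<open>real_inner\<close> through
  the axiom \<open>inner_eq_Re_cinner\<close>; see \<open>cinner_self\<close> below.
\<close>

class complex_inner_space = real_inner +
  fixes scaleC :: "complex \<Rightarrow> 'a \<Rightarrow> 'a" (infixr "*\<^sub>C" 75)
    and cinner :: "'a \<Rightarrow> 'a \<Rightarrow> complex"
  assumes scaleC_add_right: "c *\<^sub>C (x + y) = c *\<^sub>C x + c *\<^sub>C y"
    and scaleC_add_left: "(c + d) *\<^sub>C x = c *\<^sub>C x + d *\<^sub>C x"
    and scaleC_scaleC: "c *\<^sub>C (d *\<^sub>C x) = (c * d) *\<^sub>C x"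
    and scaleR_eq_scaleC: "r *\<^sub>R x = complex_of_real r *\<^sub>C x"
    and cinner_add_left: "cinner (x + y) z = cinner x z + cinner y z"
    and cinner_scaleC_left: "cinner (c *\<^sub>C x) y = c * cinner x y"
    and cinner_commute: "cinner x y = cnj (cinner y x)"
    and inner_eq_Re_cinner: "inner x y = Re (cinner x y)"

class complex_hilbert_space = complex_inner_space + banach

lemma cinner_self: "cinner x x = complex_of_real ((norm x)\<^sup>2)"
proof (rule complex_eqI)
  show "Re (cinner x x) = Re (complex_of_real ((norm x)\<^sup>2))"
    by (simp add: power2_norm_eq_inner inner_eq_Re_cinner)
  show "Im (cinner x x) = Im (complex_of_real ((norm x)\<^sup>2))"
    using arg_cong[OF cinner_commute[of x x], of Im] by simp
qed

lemma cinner_add_right: "cinner x (y + z) = cinner x y + cinner x z"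
  by (metis cinner_add_left cinner_commute complex_cnj_add)

lemma cinner_scaleC_right: "cinner x (c *\<^sub>C y) = cnj c * cinner x y"
  by (metis cinner_commute cinner_scaleC_left complex_cnj_mult)

lemma cinner_zero_left [simp]: "cinner 0 y = 0"
  using cinner_add_left[of 0 0 y] by simp

lemma cinner_zero_right [simp]: "cinner y 0 = 0"
  using cinner_add_right[of y 0 0] by simp

lemma scaleC_zero_left [simp]: "0 *\<^sub>C x = 0"
  using scaleC_add_left[of 0 0 x] by simp

lemma norm_scaleC: "norm (c *\<^sub>C x) = cmod c * norm x"
proof -
  have "complex_of_real ((norm (c *\<^sub>C x))\<^sup>2) = complex_of_real ((cmod c * norm x)\<^sup>2)"
    unfolding cinner_self[symmetric] cinner_scaleC_left cinner_scaleC_right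
    by (simp add: cinner_self power_mult_distrib complex_norm_square[of c, simplified] mult_ac)
  then have "(norm (c *\<^sub>C x))\<^sup>2 = (cmod c * norm x)\<^sup>2"
    using of_real_eq_iff by blast
  then show ?thesis by simp
qed

lemma norm_cinner_le: "cmod (cinner x y) \<le> norm x * norm y"
proof (cases "cinner x y = 0")
  case False
  define c where "c = cnj (cinner x y) / of_real (cmod (cinner x y))"
  have c: "cmod c = 1" using False by (simp add: c_def norm_divide)
  have "c * cinner x y = complex_of_real ((cmod (cinner x y))\<^sup>2) / of_real (cmod (cinner x y))"
    unfolding c_def complex_norm_square by (simp add: mult.commute)
  also have "\<dots> = complex_of_real (cmod (cinner x y))"
    using False by (simp add: power2_eq_square)
  finally have "cmod (cinner x y) = inner (c *\<^sub>C x) y"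
    by (simp add: inner_eq_Re_cinner cinner_scaleC_left)
  also have "\<dots> \<le> norm (c *\<^sub>C x) * norm y" by (rule norm_cauchy_schwarz)
  finally show ?thesis by (simp add: norm_scaleC c)
qed simp

instantiation complex :: complex_hilbert_space
begin
definition scaleC_complex :: "complex \<Rightarrow> complex \<Rightarrow> complex" where
  "scaleC_complex c x = c * x"
definition cinner_complex :: "complex \<Rightarrow> complex \<Rightarrow> complex" where
  "cinner_complex x y = x * cnj y"
instance
  by standard (simp_all add: scaleC_complex_def cinner_complex_def algebra_simps
      scaleR_conv_of_real inner_complex_def)
end

section \<open>Square-summable sequences\<close>

text \<open>
  Sequences with entries in an arbitrary space \<open>'h\<close>: the type \<open>complex ell2\<close>
  is $l^2(\mathbb{N})$, and \<open>'h ell2\<close> is the usual model $l^2(\mathbb{N},H)$ of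
  $H \otimes l^2(\mathbb{N})$.
\<close>

typedef (overloaded) ('h::complex_inner_space) ell2 =
  "{f :: nat \<Rightarrow> 'h. summable (\<lambda>n. (norm (f n))\<^sup>2)}"
  morphisms ell2_nth Abs_ell2
  by (rule exI[of _ "\<lambda>_. 0"]) simp

setup_lifting type_definition_ell2

lemma summable_ell2_nth: "summable (\<lambda>n. (norm (ell2_nth f n))\<^sup>2)"
  using ell2_nth by auto

lemma ell2_eqI: "(\<And>n. ell2_nth f n = ell2_nth g n) \<Longrightarrow> f = g"
  by (metis ell2_nth_inject ext)

lemma summable_norm2_add:
  fixes f g :: "nat \<Rightarrow> 'h::complex_inner_space"
  assumes "summable (\<lambda>n. (norm (f n))\<^sup>2)" "summable (\<lambda>n. (norm (g n))\<^sup>2)"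
  shows "summable (\<lambda>n. (norm (f n + g n))\<^sup>2)"
proof (rule summable_comparison_test')
  show "summable (\<lambda>n. 2 * (norm (f n))\<^sup>2 + 2 * (norm (g n))\<^sup>2)"
    using assms by (intro summable_add summable_mult)
  fix n :: nat
  have "(norm (f n + g n))\<^sup>2 \<le> (norm (f n) + norm (g n))\<^sup>2"
    by (intro power_mono norm_triangle_ineq) simp
  also have "\<dots> \<le> 2 * (norm (f n))\<^sup>2 + 2 * (norm (g n))\<^sup>2"
    using sum_squares_bound[of "norm (f n)" "norm (g n)"] by (simp add: power2_sum)
  finally show "norm ((norm (f n + g n))\<^sup>2) \<le> 2 * (norm (f n))\<^sup>2 + 2 * (norm (g n))\<^sup>2"
    by simp
qed

lemma summable_norm2_scaleC:
  fixes f :: "nat \<Rightarrow> 'h::complex_inner_space"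
  assumes "summable (\<lambda>n. (norm (f n))\<^sup>2)"
  shows "summable (\<lambda>n. (norm (c *\<^sub>C f n))\<^sup>2)"
  using assms by (auto simp: norm_scaleC power_mult_distrib intro: summable_mult)

lemma summable_cinner_ell2:
  fixes f g :: "'h::complex_inner_space ell2"
  shows "summable (\<lambda>n. cinner (ell2_nth f n) (ell2_nth g n))"
proof (rule summable_comparison_test')
  show "summable (\<lambda>n. (norm (ell2_nth f n))\<^sup>2 + (norm (ell2_nth g n))\<^sup>2)"
    by (intro summable_add summable_ell2_nth)
  fix n :: nat
  have "cmod (cinner (ell2_nth f n) (ell2_nth g n)) \<le> norm (ell2_nth f n) * norm (ell2_nth g n)"
    by (rule norm_cinner_le)
  also have "\<dots> \<le> (norm (ell2_nth f n))\<^sup>2 + (norm (ell2_nth g n))\<^sup>2"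
    using sum_squares_bound[of "norm (ell2_nth f n)" "norm (ell2_nth g n)"]
      mult_nonneg_nonneg[OF norm_ge_zero[of "ell2_nth f n"] norm_ge_zero[of "ell2_nth g n"]]
    by linarith
  finally show "norm (cinner (ell2_nth f n) (ell2_nth g n))
      \<le> (norm (ell2_nth f n))\<^sup>2 + (norm (ell2_nth g n))\<^sup>2" .
qed

instantiation ell2 :: (complex_inner_space) complex_inner_space
begin

lift_definition zero_ell2 :: "'a ell2" is "\<lambda>_. 0" by simp
lift_definition plus_ell2 :: "'a ell2 \<Rightarrow> 'a ell2 \<Rightarrow> 'a ell2" is "\<lambda>f g n. f n + g n"
  by (rule summable_norm2_add)
lift_definition uminus_ell2 :: "'a ell2 \<Rightarrow> 'a ell2" is "\<lambda>f n. - f n" by simp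
lift_definition minus_ell2 :: "'a ell2 \<Rightarrow> 'a ell2 \<Rightarrow> 'a ell2" is "\<lambda>f g n. f n - g n"
  subgoal for f g using summable_norm2_add[of f "\<lambda>n. - g n"] by simp
  done
lift_definition scaleC_ell2 :: "complex \<Rightarrow> 'a ell2 \<Rightarrow> 'a ell2" is "\<lambda>c f n. c *\<^sub>C f n"
  by (rule summable_norm2_scaleC)
definition scaleR_ell2 :: "real \<Rightarrow> 'a ell2 \<Rightarrow> 'a ell2" where
  "scaleR_ell2 r f = complex_of_real r *\<^sub>C f"
definition cinner_ell2 :: "'a ell2 \<Rightarrow> 'a ell2 \<Rightarrow> complex" where
  "cinner_ell2 f g = (\<Sum>n. cinner (ell2_nth f n) (ell2_nth g n))"
definition inner_ell2 :: "'a ell2 \<Rightarrow> 'a ell2 \<Rightarrow> real" where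
  "inner_ell2 f g = Re (cinner f g)"
definition norm_ell2 :: "'a ell2 \<Rightarrow> real" where
  "norm_ell2 f = sqrt (inner f f)"
definition sgn_ell2 :: "'a ell2 \<Rightarrow> 'a ell2" where
  "sgn_ell2 f = inverse (norm f) *\<^sub>R f"
definition dist_ell2 :: "'a ell2 \<Rightarrow> 'a ell2 \<Rightarrow> real" where
  "dist_ell2 f g = norm (f - g)"
definition uniformity_ell2 :: "('a ell2 \<times> 'a ell2) filter" where
  "uniformity_ell2 = (INF e\<in>{0<..}. principal {(x, y). dist x y < e})"
definition open_ell2 :: "'a ell2 set \<Rightarrow> bool" where
  "open_ell2 U = (\<forall>x\<in>U. eventually (\<lambda>(x', y). x' = x \<longrightarrow> y \<in> U) uniformity)"

instance
proof
  fix f g h :: "'a ell2" and c d :: complex and r s :: real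
  note nth = zero_ell2.rep_eq plus_ell2.rep_eq uminus_ell2.rep_eq minus_ell2.rep_eq
    scaleC_ell2.rep_eq
  show "f + g + h = f + (g + h)" "f + g = g + f" "0 + f = f" "- f + f = 0" "f - g = f + - g"
    by (auto intro!: ell2_eqI simp: nth)
  show c1: "c *\<^sub>C (f + g) = c *\<^sub>C f + c *\<^sub>C g" "(c + d) *\<^sub>C f = c *\<^sub>C f + d *\<^sub>C f"
      "c *\<^sub>C (d *\<^sub>C f) = (c * d) *\<^sub>C f"
    by (auto intro!: ell2_eqI simp: nth scaleC_add_right scaleC_add_left scaleC_scaleC)
  show "r *\<^sub>R f = complex_of_real r *\<^sub>C f" by (rule scaleR_ell2_def)
  have nthR: "ell2_nth (r *\<^sub>R f) n = r *\<^sub>R ell2_nth f n" for r n and f :: "'a ell2"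
    by (simp add: scaleR_ell2_def nth scaleR_eq_scaleC)
  show "r *\<^sub>R (f + g) = r *\<^sub>R f + r *\<^sub>R g" "(r + s) *\<^sub>R f = r *\<^sub>R f + s *\<^sub>R f"
      "r *\<^sub>R s *\<^sub>R f = (r * s) *\<^sub>R f" "1 *\<^sub>R f = f"
    by (rule ell2_eqI, simp add: nth nthR algebra_simps)+
  show add: "cinner (f + g) h = cinner f h + cinner g h"
    by (simp add: cinner_ell2_def nth cinner_add_left suminf_add summable_cinner_ell2)
  show scale: "cinner (c *\<^sub>C f) g = c * cinner f g"
    by (simp add: cinner_ell2_def nth cinner_scaleC_left suminf_mult summable_cinner_ell2)
  have comm: "cinner f g = cnj (cinner g f)" for f g :: "'a ell2"
  proof -
    have "(\<lambda>n. cnj (cinner (ell2_nth g n) (ell2_nth f n))) sums cnj (cinner g f)"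
      unfolding cinner_ell2_def sums_cnj by (rule summable_sums[OF summable_cinner_ell2])
    then show ?thesis
      unfolding cinner_ell2_def[of f g] by (simp add: sums_iff flip: cinner_commute)
  qed
  then show "cinner f g = cnj (cinner g f)" .
  show "inner f g = Re (cinner f g)" by (rule inner_ell2_def)
  show "inner f g = inner g f"
    unfolding inner_ell2_def by (subst comm) simp
  show "inner (f + g) h = inner f h + inner g h"
    unfolding inner_ell2_def add by simp
  show "inner (r *\<^sub>R f) g = r * inner f g"
    by (simp add: inner_ell2_def scaleR_ell2_def cinner_ell2_def nth cinner_scaleC_left
        suminf_mult summable_cinner_ell2)
  have ff: "inner f f = (\<Sum>n. (norm (ell2_nth f n))\<^sup>2)"
    unfolding inner_ell2_def cinner_ell2_def cinner_self
    by (subst suminf_of_real[OF summable_ell2_nth, symmetric]) simp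
  show "0 \<le> inner f f"
    unfolding ff by (intro suminf_nonneg summable_ell2_nth) simp
  show "(inner f f = 0) = (f = 0)"
    unfolding ff by (subst suminf_eq_zero_iff[OF summable_ell2_nth])
      (auto intro!: ell2_eqI simp: nth)
  show "norm f = sqrt (inner f f)" by (rule norm_ell2_def)
  show "sgn f = inverse (norm f) *\<^sub>R f" by (rule sgn_ell2_def)
  show "dist f g = norm (f - g)" by (rule dist_ell2_def)
  show "(uniformity :: ('a ell2 \<times> 'a ell2) filter)
      = (INF e\<in>{0<..}. principal {(x, y). dist x y < e})"
    by (rule uniformity_ell2_def)
  show "open U = (\<forall>x\<in>U. \<forall>\<^sub>F (x', y) in uniformity. x' = x \<longrightarrow> y \<in> U)" for U :: "'a ell2 set"
    by (rule open_ell2_def)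
qed

end

lemmas ell2_nth_simps = zero_ell2.rep_eq plus_ell2.rep_eq uminus_ell2.rep_eq
  minus_ell2.rep_eq scaleC_ell2.rep_eq

lemma norm_ell2_square: "(norm f)\<^sup>2 = (\<Sum>n. (norm (ell2_nth f n))\<^sup>2)"
proof -
  have "complex_of_real ((norm f)\<^sup>2) = (\<Sum>n. complex_of_real ((norm (ell2_nth f n))\<^sup>2))"
    unfolding cinner_self[symmetric] cinner_ell2_def ..
  also have "\<dots> = complex_of_real (\<Sum>n. (norm (ell2_nth f n))\<^sup>2)"
    by (rule suminf_of_real[OF summable_ell2_nth, symmetric])
  finally show ?thesis using of_real_eq_iff by blast
qed

lemma sum_norm_ell2_le: "finite I \<Longrightarrow> (\<Sum>n\<in>I. (norm (ell2_nth f n))\<^sup>2) \<le> (norm f)\<^sup>2"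
  unfolding norm_ell2_square by (intro sum_le_suminf summable_ell2_nth) auto

lemma norm_ell2_nth_le: "norm (ell2_nth f n) \<le> norm f"
  using sum_norm_ell2_le[of "{n}" f] by (simp add: power2_le_iff_abs_le)

instance ell2 :: (complex_hilbert_space) complex_hilbert_space
proof
  fix X :: "nat \<Rightarrow> 'a ell2"
  assume X: "Cauchy X"
  define g where "g n = lim (\<lambda>k. ell2_nth (X k) n)" for n
  have lim: "(\<lambda>k. ell2_nth (X k) n) \<longlonglongrightarrow> g n" for n
  proof -
    have "Cauchy (\<lambda>k. ell2_nth (X k) n)"
    proof (rule metric_CauchyI)
      fix e :: real assume "e > 0"
      then obtain N where N: "\<forall>m\<ge>N. \<forall>k\<ge>N. dist (X m) (X k) < e"
        using X unfolding Cauchy_def by blast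
      have "dist (ell2_nth (X m) n) (ell2_nth (X k) n) \<le> dist (X m) (X k)" for m k
        using norm_ell2_nth_le[of "X m - X k" n] by (simp add: dist_norm ell2_nth_simps)
      then show "\<exists>N. \<forall>m\<ge>N. \<forall>k\<ge>N. dist (ell2_nth (X m) n) (ell2_nth (X k) n) < e"
        using N by (meson le_less_trans)
    qed
    then show ?thesis
      unfolding g_def by (simp add: Cauchy_convergent_iff convergent_LIMSEQ_iff)
  qed
  have tail: "\<exists>N. \<forall>m\<ge>N. \<forall>I. finite I \<longrightarrow> (\<Sum>n\<in>I. (norm (ell2_nth (X m) n - g n))\<^sup>2) \<le> e\<^sup>2"
    if "e > 0" for e :: real
  proof -
    obtain N where N: "\<forall>m\<ge>N. \<forall>k\<ge>N. dist (X m) (X k) < e"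
      using X \<open>e > 0\<close> unfolding Cauchy_def by blast
    have "(\<Sum>n\<in>I. (norm (ell2_nth (X m) n - g n))\<^sup>2) \<le> e\<^sup>2" if "m \<ge> N" "finite I" for m I
    proof (rule LIMSEQ_le_const2)
      show "(\<lambda>k. \<Sum>n\<in>I. (norm (ell2_nth (X m) n - ell2_nth (X k) n))\<^sup>2)
          \<longlonglongrightarrow> (\<Sum>n\<in>I. (norm (ell2_nth (X m) n - g n))\<^sup>2)"
        by (intro tendsto_intros lim)
      have "(\<Sum>n\<in>I. (norm (ell2_nth (X m) n - ell2_nth (X k) n))\<^sup>2) \<le> e\<^sup>2" if "k \<ge> N" for k
      proof -
        have "(\<Sum>n\<in>I. (norm (ell2_nth (X m) n - ell2_nth (X k) n))\<^sup>2) \<le> (norm (X m - X k))\<^sup>2"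
          using sum_norm_ell2_le[OF \<open>finite I\<close>, of "X m - X k"] by (simp add: ell2_nth_simps)
        also have "\<dots> \<le> e\<^sup>2"
          using N \<open>m \<ge> N\<close> \<open>k \<ge> N\<close> by (intro power_mono) (auto simp: dist_norm less_imp_le)
        finally show ?thesis .
      qed
      then show "\<exists>N. \<forall>k\<ge>N. (\<Sum>n\<in>I. (norm (ell2_nth (X m) n - ell2_nth (X k) n))\<^sup>2) \<le> e\<^sup>2"
        by blast
    qed
    then show ?thesis by blast
  qed
  have diff: "summable (\<lambda>n. (norm (ell2_nth (X m) n - g n))\<^sup>2)"
    if "\<forall>I. finite I \<longrightarrow> (\<Sum>n\<in>I. (norm (ell2_nth (X m) n - g n))\<^sup>2) \<le> e\<^sup>2" for m and e :: real
    by (rule summableI_nonneg_bounded[where x = "e\<^sup>2"]) (use that in auto)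
  have "summable (\<lambda>n. (norm (g n))\<^sup>2)"
  proof -
    obtain m where "\<forall>I. finite I \<longrightarrow> (\<Sum>n\<in>I. (norm (ell2_nth (X m) n - g n))\<^sup>2) \<le> 1\<^sup>2"
      using tail[of 1] by auto
    from diff[OF this] have "summable (\<lambda>n. (norm (g n - ell2_nth (X m) n))\<^sup>2)"
      by (simp add: norm_minus_commute)
    from summable_norm2_add[OF this summable_ell2_nth[of "X m"]] show ?thesis by simp
  qed
  then have G: "ell2_nth (Abs_ell2 g) = g" by (simp add: Abs_ell2_inverse)
  have "X \<longlonglongrightarrow> Abs_ell2 g"
  proof (rule metric_LIMSEQ_I)
    fix r :: real assume "r > 0"
    then obtain N where N: "\<forall>m\<ge>N. \<forall>I. finite I \<longrightarrow>
        (\<Sum>n\<in>I. (norm (ell2_nth (X m) n - g n))\<^sup>2) \<le> (r / 2)\<^sup>2"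
      using tail[of "r / 2"] by auto
    have "dist (X m) (Abs_ell2 g) < r" if "m \<ge> N" for m
    proof -
      have "(norm (X m - Abs_ell2 g))\<^sup>2 = (\<Sum>n. (norm (ell2_nth (X m) n - g n))\<^sup>2)"
        by (simp add: norm_ell2_square ell2_nth_simps G)
      also have "\<dots> \<le> (r / 2)\<^sup>2"
        using N that by (intro suminf_le_const diff[where e = "r / 2"]) auto
      finally have "norm (X m - Abs_ell2 g) \<le> r / 2"
        using \<open>r > 0\<close> by (simp add: power2_le_iff_abs_le)
      then show ?thesis using \<open>r > 0\<close> by (simp add: dist_norm)
    qed
    then show "\<exists>N. \<forall>m\<ge>N. dist (X m) (Abs_ell2 g) < r" by blast
  qed
  then show "convergent X" by (rule convergentI)
qed

section \<open>Bounded operators and von Neumann algebras\<close>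

text \<open>The algebra $\mathcal{B}(H)$; products of operators are compositions.\<close>

definition bounded_ops :: "('h::complex_hilbert_space \<Rightarrow> 'h) set" where
  "bounded_ops = {A. bounded_linear A \<and> (\<forall>c x. A (c *\<^sub>C x) = c *\<^sub>C A x)}"

definition adj :: "('h::complex_hilbert_space \<Rightarrow> 'h) \<Rightarrow> 'h \<Rightarrow> 'h" where
  "adj A = (THE B. \<forall>x y. cinner (A x) y = cinner x (B y))"

definition commutant :: "('h::complex_hilbert_space \<Rightarrow> 'h) set \<Rightarrow> ('h \<Rightarrow> 'h) set" where
  "commutant S = {T \<in> bounded_ops. \<forall>A\<in>S. T \<circ> A = A \<circ> T}"

definition vn_algebra :: "('h::complex_hilbert_space \<Rightarrow> 'h) set \<Rightarrow> bool" where
  "vn_algebra M \<longleftrightarrow> M \<subseteq> bounded_ops \<and> (\<forall>A\<in>M. adj A \<in> M) \<and> commutant (commutant M) = M"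

text \<open>The identity operator lies in every bicommutant, so subalgebras are unital.\<close>

definition vn_subalgebra ::
    "('h::complex_hilbert_space \<Rightarrow> 'h) set \<Rightarrow> ('h \<Rightarrow> 'h) set \<Rightarrow> bool" where
  "vn_subalgebra N M \<longleftrightarrow> vn_algebra N \<and> vn_algebra M \<and> N \<subseteq> M"

section \<open>Factors of type $\mathrm{II}_1$\<close>

definition projections :: "('h::complex_hilbert_space \<Rightarrow> 'h) set \<Rightarrow> ('h \<Rightarrow> 'h) set" where
  "projections M = {E \<in> M. E \<circ> E = E \<and> adj E = E}"

text \<open>Murray--von Neumann equivalence relative to \<open>M\<close>.\<close>

definition mvn_equiv ::
    "('h::complex_hilbert_space \<Rightarrow> 'h) set \<Rightarrow> ('h \<Rightarrow> 'h) \<Rightarrow> ('h \<Rightarrow> 'h) \<Rightarrow> bool" where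
  "mvn_equiv M E F \<longleftrightarrow> (\<exists>V\<in>M. adj V \<circ> V = E \<and> V \<circ> adj V = F)"

text \<open>For projections, \<open>E \<circ> F = F\<close> says $F \le E$.\<close>

definition finite_projection ::
    "('h::complex_hilbert_space \<Rightarrow> 'h) set \<Rightarrow> ('h \<Rightarrow> 'h) \<Rightarrow> bool" where
  "finite_projection M E \<longleftrightarrow> E \<in> projections M \<and>
     (\<forall>F\<in>projections M. E \<circ> F = F \<and> mvn_equiv M E F \<longrightarrow> F = E)"

definition abelian_projection ::
    "('h::complex_hilbert_space \<Rightarrow> 'h) set \<Rightarrow> ('h \<Rightarrow> 'h) \<Rightarrow> bool" where
  "abelian_projection M E \<longleftrightarrow> E \<in> projections M \<and>
     (\<forall>A\<in>M. \<forall>B\<in>M. (E \<circ> A \<circ> E) \<circ> (E \<circ> B \<circ> E) = (E \<circ> B \<circ> E) \<circ> (E \<circ> A \<circ> E))"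

text \<open>
  Type $\mathrm{II}$ requires no nonzero abelian projection and a finite projection
  with central carrier the identity; for type $\mathrm{II}_1$ the identity itself is such
  a finite projection.
\<close>

definition type_II1 :: "('h::complex_hilbert_space \<Rightarrow> 'h) set \<Rightarrow> bool" where
  "type_II1 M \<longleftrightarrow> vn_algebra M \<and> finite_projection M id \<and>
     (\<forall>E. abelian_projection M E \<longrightarrow> E = (\<lambda>_. 0))"

text \<open>The second condition excludes the algebra on the zero Hilbert space.\<close>

definition factor :: "('h::complex_hilbert_space \<Rightarrow> 'h) set \<Rightarrow> bool" where
  "factor M \<longleftrightarrow> vn_algebra M \<and> (id :: 'h \<Rightarrow> 'h) \<noteq> (\<lambda>_. 0) \<and>
     M \<inter> commutant M = {\<lambda>x. c *\<^sub>C x | c. True}"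

section \<open>Normalizers\<close>

definition unitary_op :: "('h::complex_hilbert_space \<Rightarrow> 'h) \<Rightarrow> bool" where
  "unitary_op U \<longleftrightarrow> U \<in> bounded_ops \<and> adj U \<circ> U = id \<and> U \<circ> adj U = id"

definition normalizer ::
    "('h::complex_hilbert_space \<Rightarrow> 'h) set \<Rightarrow> ('h \<Rightarrow> 'h) set \<Rightarrow> ('h \<Rightarrow> 'h) set" where
  "normalizer M N = {U \<in> M. unitary_op U \<and> (\<lambda>A. U \<circ> A \<circ> adj U) ` N = N}"

definition singular_in ::
    "('h::complex_hilbert_space \<Rightarrow> 'h) set \<Rightarrow> ('h \<Rightarrow> 'h) set \<Rightarrow> bool" where
  "singular_in N M \<longleftrightarrow> vn_subalgebra N M \<and> normalizer M N \<subseteq> N"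

definition regular_in ::
    "('h::complex_hilbert_space \<Rightarrow> 'h) set \<Rightarrow> ('h \<Rightarrow> 'h) set \<Rightarrow> bool" where
  "regular_in N M \<longleftrightarrow> vn_subalgebra N M \<and> commutant (commutant (normalizer M N)) = M"

section \<open>Tensor products\<close>

text \<open>
  A bilinear map \<open>t\<close> exhibits its target as the Hilbert space tensor product of its two
  arguments. The set of elementary tensors is closed under complex scaling, so its real
  span is its complex span.
\<close>

definition hilbert_tensor ::
    "('h::complex_hilbert_space \<Rightarrow> 'l::complex_hilbert_space \<Rightarrow> 'k::complex_hilbert_space) \<Rightarrow> bool" where
  "hilbert_tensor t \<longleftrightarrow>
     (\<forall>x x' y. t (x + x') y = t x y + t x' y) \<and> (\<forall>c x y. t (c *\<^sub>C x) y = c *\<^sub>C t x y) \<and>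
     (\<forall>x y y'. t x (y + y') = t x y + t x y') \<and> (\<forall>c x y. t x (c *\<^sub>C y) = c *\<^sub>C t x y) \<and>
     (\<forall>x y x' y'. cinner (t x y) (t x' y') = cinner x x' * cinner y y') \<and>
     closure (span {t x y | x y. True}) = UNIV"

text \<open>
  The tensor product of two von Neumann algebras: the von Neumann algebra on the tensor
  product space generated by the operators $A \otimes B$, where $T = A \otimes B$ is expressed by
  its values on elementary tensors.
\<close>

definition vn_tensor ::
    "('h::complex_hilbert_space \<Rightarrow> 'l::complex_hilbert_space \<Rightarrow> 'k::complex_hilbert_space) \<Rightarrow>
     ('h \<Rightarrow> 'h) set \<Rightarrow> ('l \<Rightarrow> 'l) set \<Rightarrow> ('k \<Rightarrow> 'k) set" where
  "vn_tensor t M N = commutant (commutant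
     {T \<in> bounded_ops. \<exists>A\<in>M. \<exists>B\<in>N. \<forall>x y. T (t x y) = t (A x) (B y)})"

text \<open>The elementary tensors $x \otimes \xi$ in $H \otimes l^2(\mathbb{N}) = l^2(\mathbb{N},H)$.\<close>

lift_definition ell2_tensor ::
    "'h::complex_hilbert_space \<Rightarrow> complex ell2 \<Rightarrow> 'h ell2" is "\<lambda>x \<xi> n. \<xi> n *\<^sub>C x"
  by (auto simp: norm_scaleC power_mult_distrib intro: summable_mult2)

lift_definition ell2_single :: "nat \<Rightarrow> 'h::complex_inner_space \<Rightarrow> 'h ell2" is
  "\<lambda>k x n. if n = k then x else 0"
  by (rule summable_finite[of "{k}" for k]) auto

lemma ell2_nth_sum: "ell2_nth (\<Sum>i\<in>I. f i) n = (\<Sum>i\<in>I. ell2_nth (f i) n)"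
  by (induction I rule: infinite_finite_induct) (simp_all add: ell2_nth_simps)

lemma ell2_single_sums: "(\<lambda>k. ell2_single k (ell2_nth f k)) sums f"
  unfolding sums_def
proof (rule metric_LIMSEQ_I)
  fix r :: real assume r: "r > 0"
  let ?s = "\<lambda>n. (norm (ell2_nth f n))\<^sup>2"
  have "(\<lambda>N. (norm f)\<^sup>2 - (\<Sum>n<N. ?s n)) \<longlonglongrightarrow> (norm f)\<^sup>2 - (norm f)\<^sup>2"
    unfolding norm_ell2_square by (intro tendsto_intros summable_LIMSEQ summable_ell2_nth)
  then have "\<forall>\<^sub>F N in sequentially. (norm f)\<^sup>2 - (\<Sum>n<N. ?s n) < r\<^sup>2"
    using r by (intro order_tendstoD(2)) auto
  moreover have "(norm ((\<Sum>k<N. ell2_single k (ell2_nth f k)) - f))\<^sup>2 = (norm f)\<^sup>2 - (\<Sum>n<N. ?s n)" for N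
  proof -
    have nth: "ell2_nth ((\<Sum>k<N. ell2_single k (ell2_nth f k)) - f) n
        = (if n < N then 0 else - ell2_nth f n)" for n
      by (simp add: ell2_nth_simps ell2_nth_sum ell2_single.rep_eq)
    have "(norm ((\<Sum>k<N. ell2_single k (ell2_nth f k)) - f))\<^sup>2
        = (\<Sum>n. ?s n - (if n < N then ?s n else 0))"
      unfolding norm_ell2_square nth by (intro suminf_cong) auto
    also have "\<dots> = (\<Sum>n. ?s n) - (\<Sum>n. if n < N then ?s n else 0)"
      by (intro suminf_diff[symmetric] summable_ell2_nth summable_finite[of "{..<N}"]) auto
    also have "(\<Sum>n. if n < N then ?s n else 0) = (\<Sum>n<N. ?s n)"
      by (subst suminf_finite[of "{..<N}"]) auto
    finally show ?thesis by (simp add: norm_ell2_square)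
  qed
  ultimately have "\<forall>\<^sub>F N in sequentially. dist (\<Sum>k<N. ell2_single k (ell2_nth f k)) f < r"
    using r by (auto simp: dist_norm elim!: eventually_mono intro: power2_less_imp_less)
  then show "\<exists>N0. \<forall>N\<ge>N0. dist (\<Sum>k<N. ell2_single k (ell2_nth f k)) f < r"
    by (simp add: eventually_sequentially)
qed

lemma hilbert_tensor_ell2_tensor: "hilbert_tensor ell2_tensor"
  unfolding hilbert_tensor_def
proof (intro conjI allI)
  fix x x' :: 'a and y y' :: "complex ell2" and c :: complex
  show "ell2_tensor (x + x') y = ell2_tensor x y + ell2_tensor x' y"
    "ell2_tensor (c *\<^sub>C x) y = c *\<^sub>C ell2_tensor x y"
    "ell2_tensor x (y + y') = ell2_tensor x y + ell2_tensor x y'"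
    "ell2_tensor x (c *\<^sub>C y) = c *\<^sub>C ell2_tensor x y"
    by (auto intro!: ell2_eqI simp: ell2_nth_simps ell2_tensor.rep_eq scaleC_add_right
        scaleC_add_left scaleC_scaleC scaleC_complex_def mult.commute)
  have "cinner (ell2_tensor x y) (ell2_tensor x' y')
      = (\<Sum>n. cinner x x' * cinner (ell2_nth y n) (ell2_nth y' n))"
    unfolding cinner_ell2_def
    by (simp add: ell2_tensor.rep_eq cinner_scaleC_left cinner_scaleC_right cinner_complex_def
        algebra_simps)
  also have "\<dots> = cinner x x' * cinner y y'"
    unfolding cinner_ell2_def by (rule suminf_mult[OF summable_cinner_ell2])
  finally show "cinner (ell2_tensor x y) (ell2_tensor x' y') = cinner x x' * cinner y y'" .
next
  let ?S = "{ell2_tensor x y | x y. True} :: 'a ell2 set"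
  have "f \<in> closure (span ?S)" for f :: "'a ell2"
  proof -
    have "ell2_single k x = ell2_tensor x (ell2_single k 1)" for k and x :: 'a
      by (auto intro!: ell2_eqI simp: ell2_single.rep_eq ell2_tensor.rep_eq)
         (metis of_real_1 scaleR_eq_scaleC scaleR_one)
    then have "(\<Sum>k<N. ell2_single k (ell2_nth f k)) \<in> span ?S" for N
      by (intro span_sum span_base) blast
    then show ?thesis
      using ell2_single_sums[of f] unfolding sums_def closure_sequential
      by (intro exI[of _ "\<lambda>N. \<Sum>k<N. ell2_single k (ell2_nth f k)"] conjI allI)
  qed
  then show "closure (span ?S) = UNIV" by auto
qed

end

theory Submission
  imports Defs
begin

text \<open>
  The algebra \<open>N\<close> is the relative commutant \<open>M \<inter> {P}'\<close> of a projection \<open>P\<close> in \<open>M\<close>, that is,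
  the block-diagonal algebra \<open>P M P \<oplus> (1 - P) M (1 - P)\<close>.

  Singularity: the only projections of \<open>M\<close> that commute with all of \<open>N\<close> are
  \<open>0\<close>, \<open>P\<close>, \<open>1 - P\<close> and \<open>1\<close>, because in a factor \<open>E M F = 0\<close> forces \<open>E = 0\<close> or \<open>F = 0\<close>. A unitary
  that normalizes \<open>N\<close> therefore maps \<open>P\<close> to \<open>P\<close> or to \<open>1 - P\<close>. If \<open>P\<close> and \<open>1 - P\<close> are inequivalent, only
  the first is possible, and the unitary lies in \<open>N\<close> (\<open>normalizer_relative_commutant\<close>).

  Regularity: if \<open>P \<otimes> 1\<close> and \<open>(1 - P) \<otimes> 1\<close> are equivalent in \<open>M \<otimes> B(l\<^sup>2)\<close>, a symmetry exchanges
  them; it normalizes \<open>N \<otimes> B(l\<^sup>2)\<close>, which is the relative commutant of \<open>P \<otimes> 1\<close>, and generates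
  \<open>M \<otimes> B(l\<^sup>2)\<close> together with it (\<open>regular_relative_commutant\<close>).

  Both conditions hold if the identity is the sum of four equivalent projections, one of which
  is \<open>P\<close> (\<open>quarter\<close>): finiteness of \<open>M\<close> makes \<open>P\<close> and \<open>1 - P\<close> inequivalent, whereas three copies
  of \<open>P \<otimes> 1\<close> are equivalent to one copy (\<open>amplified_equivalence\<close>). The four projections come from
  halving the identity twice. For the halving, take a maximal orthogonal family of pairs of
  equivalent orthogonal projections, each encoded by two projections at angle \<open>\<pi>/4\<close>
  (\<open>halving\<close>). Such a pair exists below every nonzero projection (\<open>half_angle_below\<close>), since a
  projection without proper subprojections in \<open>M\<close> would be abelian
  (\<open>minimal_projection_corner\<close>). No trace and no comparison theory is needed.

  The spectral theory behind this is reduced to two facts: the projection onto a common kernel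
  of elements of \<open>M\<close> is in \<open>M\<close> (\<open>kernel_projection\<close>), and positive operators of the form \<open>1 - B\<close>
  with \<open>B\<close> a self-adjoint contraction have square roots (\<open>sqrt_one_minus\<close>).
\<close>

section \<open>Orthogonal projections and adjoints\<close>

lemma orthogonal_projection_exists:
  fixes K :: "'a::{real_inner,banach} set"
  assumes K: "subspace K" "closed K"
  obtains p where "p \<in> K" "\<And>k. k \<in> K \<Longrightarrow> inner (x - p) k = 0"
proof -
  define d where "d = infdist x K"
  have ne: "K \<noteq> {}" using subspace_0[OF K(1)] by auto
  have d0: "d \<ge> 0" unfolding d_def by (rule infdist_nonneg)
  have dle: "d \<le> norm (x - k)" if "k \<in> K" for k
    unfolding d_def using infdist_le[OF that, of x] by (simp add: dist_norm)
  have "\<exists>k\<in>K. norm (x - k) < d + inverse (Suc n)" for n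
  proof -
    have "infdist x K < d + inverse (Suc n)" by (simp add: d_def)
    then show ?thesis
      unfolding infdist_notempty[OF ne]
      by (subst (asm) cINF_less_iff) (use ne in \<open>auto simp: dist_norm intro!: bdd_belowI[where m=0]\<close>)
  qed
  then obtain k where k: "\<And>n. k n \<in> K" "\<And>n. norm (x - k n) < d + inverse (Suc n)"
    by metis
  \<comment> \<open>Parallelogram law for \<open>x - k n\<close> and \<open>x - k m\<close>, whose mean has norm at least \<open>d\<close>.\<close>
  have par: "(norm (k n - k m))\<^sup>2 \<le> (8 * d + 4) * inverse (Suc N)" if "n \<ge> N" "m \<ge> N" for n m N
  proof -
    let ?u = "x - k n" and ?v = "x - k m" and ?a = "inverse (real (Suc N))"
    have "(1/2) *\<^sub>R (k n + k m) \<in> K"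
      using K(1) k(1) by (intro subspace_mul subspace_add) auto
    from dle[OF this] have "2 * d \<le> 2 * norm (x - (1/2) *\<^sub>R (k n + k m))" by simp
    also have "\<dots> = norm (2 *\<^sub>R (x - (1/2) *\<^sub>R (k n + k m)))" by simp
    also have "2 *\<^sub>R (x - (1/2) *\<^sub>R (k n + k m)) = ?u + ?v" by (simp add: algebra_simps scaleR_2)
    finally have lower: "(2 * d)\<^sup>2 \<le> (norm (?u + ?v))\<^sup>2" using d0 by (intro power_mono) auto
    have parallelogram: "(norm (k n - k m))\<^sup>2 = 2 * (norm ?u)\<^sup>2 + 2 * (norm ?v)\<^sup>2 - (norm (?u + ?v))\<^sup>2"
      by (simp add: power2_norm_eq_inner inner_simps inner_commute)
    have le: "(norm (x - k i))\<^sup>2 \<le> d\<^sup>2 + (2 * d + 1) * ?a" if "i \<ge> N" for i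
    proof -
      have i: "inverse (real (Suc i)) \<le> ?a" using that by (intro le_imp_inverse_le) auto
      have "norm (x - k i) \<le> d + ?a" using k(2)[of i] i by linarith
      then have "(norm (x - k i))\<^sup>2 \<le> (d + ?a)\<^sup>2" by (intro power_mono) auto
      also have "\<dots> = d\<^sup>2 + 2 * d * ?a + ?a * ?a" by (simp add: power2_eq_square algebra_simps)
      also have "?a * ?a \<le> 1 * ?a" by (intro mult_right_mono) (auto simp: field_simps)
      finally show ?thesis by (simp add: algebra_simps)
    qed
    have "(norm (k n - k m))\<^sup>2 \<le> 2 * (d\<^sup>2 + (2 * d + 1) * ?a) + 2 * (d\<^sup>2 + (2 * d + 1) * ?a) - (2*d)\<^sup>2"
      unfolding parallelogram using le[OF that(1)] le[OF that(2)] lower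
      by (intro diff_mono add_mono mult_left_mono) auto
    then show ?thesis by (simp add: power2_eq_square algebra_simps)
  qed
  have "Cauchy k"
  proof (rule metric_CauchyI)
    fix e :: real assume e: "e > 0"
    have "(\<lambda>N. (8 * d + 4) * inverse (real (Suc N))) \<longlonglongrightarrow> (8 * d + 4) * 0"
      by (intro tendsto_intros LIMSEQ_inverse_real_of_nat)
    then have "\<forall>\<^sub>F N in sequentially. (8 * d + 4) * inverse (real (Suc N)) < e\<^sup>2"
      using e by (intro order_tendstoD(2)) auto
    then obtain N where N: "(8 * d + 4) * inverse (real (Suc N)) < e\<^sup>2"
      by (auto simp: eventually_sequentially)
    have "dist (k n) (k m) < e" if "n \<ge> N" "m \<ge> N" for n m
      unfolding dist_norm using par[OF that] N e by (intro power2_less_imp_less[of _ e]) auto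
    then show "\<exists>N. \<forall>n\<ge>N. \<forall>m\<ge>N. dist (k n) (k m) < e" by blast
  qed
  then obtain p where p: "k \<longlonglongrightarrow> p" by (meson Cauchy_convergent convergent_def)
  have pK: "p \<in> K" using closed_sequentially[OF K(2) k(1) p] .
  have "(\<lambda>n. norm (x - k n)) \<longlonglongrightarrow> norm (x - p)" by (intro tendsto_intros p)
  moreover have "(\<lambda>n. d + inverse (Suc n)) \<longlonglongrightarrow> d + 0"
    by (intro tendsto_intros LIMSEQ_inverse_real_of_nat)
  ultimately have "norm (x - p) \<le> d + 0"
    by (rule LIMSEQ_le) (use k(2) less_imp_le in blast)
  then have pd: "norm (x - p) \<le> d" by simp
  have "inner (x - p) k = 0" if kK: "k \<in> K" for k
  proof (cases "k = 0")
    case False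
    \<comment> \<open>The best multiple of \<open>k\<close> to add to \<open>p\<close>; it must not improve the distance.\<close>
    define t where "t = inner (x - p) k / inner k k"
    have "p + t *\<^sub>R k \<in> K" using K(1) pK kK by (intro subspace_mul subspace_add) auto
    from dle[OF this] pd have "norm (x - p) \<le> norm (x - p - t *\<^sub>R k)" by (simp add: diff_diff_eq)
    then have "(norm (x - p))\<^sup>2 \<le> (norm (x - p - t *\<^sub>R k))\<^sup>2" by (intro power_mono) auto
    also have "\<dots> = (norm (x - p))\<^sup>2 - 2 * t * inner (x - p) k + t * t * inner k k"
      unfolding power2_norm_eq_inner
      by (simp add: inner_diff_left inner_diff_right inner_commute algebra_simps)
    also have "\<dots> = (norm (x - p))\<^sup>2 - (inner (x - p) k)\<^sup>2 / inner k k"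
      using False by (simp add: t_def field_simps power2_eq_square)
    finally have "(inner (x - p) k)\<^sup>2 / inner k k \<le> 0" by simp
    moreover have "inner k k > 0" using False by simp
    ultimately show ?thesis by (simp add: divide_le_0_iff)
  qed simp
  with pK that show ?thesis by blast
qed

text \<open>Stated for the real inner product; the complex adjoint relation follows from the real one
  by replacing \<open>x\<close> with \<open>\<i> x\<close>.\<close>

lemma riesz_representation:
  fixes f :: "'a::{real_inner,banach} \<Rightarrow> real"
  assumes f: "bounded_linear f"
  obtains z where "\<And>x. f x = inner x z"
proof (cases "\<forall>x. f x = 0")
  case True
  then show ?thesis using that[of 0] by simp
next
  case False
  then obtain x0 where x0: "f x0 \<noteq> 0" by blast
  interpret f: bounded_linear f by fact
  let ?K = "{x. f x = 0}"
  have "subspace ?K" by (auto simp: subspace_def f.add f.scaleR f.zero)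
  moreover have "closed ?K"
    by (intro closed_Collect_eq continuous_on_const f.continuous_on continuous_on_id)
  ultimately obtain p where p: "f p = 0" "\<And>k. f k = 0 \<Longrightarrow> inner (x0 - p) k = 0"
    by (rule orthogonal_projection_exists[of ?K x0]) auto
  define u where "u = x0 - p"
  have fu: "f u \<noteq> 0" using x0 p(1) by (simp add: u_def f.diff)
  then have u: "inner u u \<noteq> 0" using f.zero by auto
  have "f x = inner x ((f u / inner u u) *\<^sub>R u)" for x
  proof -
    have "inner u (x - (f x / f u) *\<^sub>R u) = 0"
      unfolding u_def by (rule p(2)) (use fu in \<open>simp add: f.diff f.scaleR u_def[symmetric]\<close>)
    then have "inner x u = (f x / f u) * inner u u"
      by (simp add: inner_diff_right inner_commute)
    then show ?thesis using fu u by simp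
  qed
  then show ?thesis using that by blast
qed

lemma inner_eqI:
  assumes "\<And>x. inner x y = inner x z" shows "y = z"
  by (metis assms inner_commute vector_eq_rdot)

lemma scaleC_minus_one: "(-1) *\<^sub>C (x::'h::complex_inner_space) = - x"
  by (metis of_real_1 of_real_minus scaleR_eq_scaleC scaleR_minus1_left)

lemma cinner_conv_inner: "cinner x y = Complex (inner x y) (- inner (\<i> *\<^sub>C x) y)"
  by (simp add: inner_eq_Re_cinner cinner_scaleC_left complex_eq_iff)

lemma inner_scaleC_left: "inner (c *\<^sub>C x) y = inner x (cnj c *\<^sub>C y)"
  by (simp add: inner_eq_Re_cinner cinner_scaleC_left cinner_scaleC_right)

lemma adj_exists:
  fixes A :: "'h::complex_hilbert_space \<Rightarrow> 'h"
  assumes "A \<in> bounded_ops"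
  obtains B where "B \<in> bounded_ops" "\<And>x y. inner (A x) y = inner x (B y)"
    "\<And>x y. cinner (A x) y = cinner x (B y)"
proof -
  interpret A: bounded_linear A using assms by (simp add: bounded_ops_def)
  have "\<exists>z. \<forall>x. inner (A x) y = inner x z" for y
    using riesz_representation[OF bounded_linear_compose[OF bounded_linear_inner_left[of y] A.bounded_linear_axioms]]
    by metis
  then obtain B where B: "\<And>x y. inner (A x) y = inner x (B y)" by metis
  have AC: "A (c *\<^sub>C x) = c *\<^sub>C A x" for c x using assms by (simp add: bounded_ops_def)
  obtain C where C: "\<And>x. norm (A x) \<le> norm x * C" "C > 0" using A.pos_bounded by blast
  have "bounded_linear B"
  proof (rule bounded_linear_intro)
    show "B (x + y) = B x + B y" for x y
      by (rule inner_eqI) (simp add: inner_add_right flip: B)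
    show "B (r *\<^sub>R x) = r *\<^sub>R B x" for r x
      by (rule inner_eqI) (simp flip: B)
    show "norm (B y) \<le> norm y * C" for y
    proof (cases "B y = 0")
      case True then show ?thesis using C(2) by simp
    next
      case False
      have "norm (B y) * norm (B y) = inner (A (B y)) y"
        by (simp add: B power2_norm_eq_inner flip: power2_eq_square)
      also have "\<dots> \<le> norm (A (B y)) * norm y" by (rule norm_cauchy_schwarz)
      also have "\<dots> \<le> norm (B y) * (norm y * C)"
        using mult_right_mono[OF C(1)[of "B y"], of "norm y"] by (simp add: mult_ac)
      finally show ?thesis using False by simp
    qed
  qed
  moreover have "B (c *\<^sub>C x) = c *\<^sub>C B x" for c x
  proof (rule inner_eqI)
    fix z
    show "inner z (B (c *\<^sub>C x)) = inner z (c *\<^sub>C B x)"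
      using inner_scaleC_left[of "cnj c" "A z" x] inner_scaleC_left[of "cnj c" z "B x"]
      by (simp add: AC flip: B)
  qed
  ultimately have "B \<in> bounded_ops" by (simp add: bounded_ops_def)
  moreover have "cinner (A x) y = cinner x (B y)" for x y
    by (simp add: cinner_conv_inner B flip: AC)
  ultimately show ?thesis using that B by blast
qed

lemma adj_eqI:
  fixes A :: "'h::complex_hilbert_space \<Rightarrow> 'h"
  assumes "\<And>x y. cinner (A x) y = cinner x (B y)"
  shows "adj A = B"
  unfolding adj_def
proof (rule the_equality)
  show "\<forall>x y. cinner (A x) y = cinner x (B y)" using assms by simp
  fix B' assume "\<forall>x y. cinner (A x) y = cinner x (B' y)"
  then have "cinner x (B' y) = cinner x (B y)" for x y using assms by simp
  then have "inner x (B' y) = inner x (B y)" for x y by (simp add: inner_eq_Re_cinner)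
  then show "B' = B" by (metis ext inner_eqI)
qed

section \<open>The star-algebra of bounded operators\<close>

text \<open>Bounded operators as a type, so that their algebra is available as ring arithmetic:
  multiplication is composition and \<open>star\<close> is the adjoint.\<close>

typedef (overloaded) ('h::complex_hilbert_space) bop = "bounded_ops :: ('h \<Rightarrow> 'h) set"
  morphisms oper Abs_bop
  by (rule exI[of _ id]) (auto simp: bounded_ops_def id_def)

setup_lifting type_definition_bop

lemma bop_eqI: "(\<And>x. oper A x = oper B x) \<Longrightarrow> A = B"
  by (metis ext oper_inject)

lemma oper_bounded_linear: "bounded_linear (oper A)"
  using oper[of A] by (simp add: bounded_ops_def)

lemma oper_scaleC: "oper A (c *\<^sub>C x) = c *\<^sub>C oper A x"
  using oper[of A] by (simp add: bounded_ops_def)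

lemmas oper_add = linear_add[OF bounded_linear.linear[OF oper_bounded_linear]]
  and oper_diff = linear_diff[OF bounded_linear.linear[OF oper_bounded_linear]]
  and oper_minus = linear_neg[OF bounded_linear.linear[OF oper_bounded_linear]]
  and oper_zero = linear_0[OF bounded_linear.linear[OF oper_bounded_linear]]
  and oper_scaleR = linear_cmul[OF bounded_linear.linear[OF oper_bounded_linear]]

lemma scaleC_zero_right: "c *\<^sub>C 0 = (0::'h::complex_inner_space)"
  using scaleC_add_right[of c 0 0] by simp

lemma scaleC_minus_right: "c *\<^sub>C (- x) = - (c *\<^sub>C (x::'h::complex_inner_space))"
  using scaleC_add_right[of c x "- x"] by (simp add: scaleC_zero_right eq_neg_iff_add_eq_0 add.commute)

lemma scaleC_diff_right: "c *\<^sub>C (x - y) = c *\<^sub>C x - c *\<^sub>C (y::'h::complex_inner_space)"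
  using scaleC_add_right[of c x "- y"] by (simp add: scaleC_minus_right)

lemma scaleC_scaleR: "c *\<^sub>C (r *\<^sub>R x) = r *\<^sub>R (c *\<^sub>C (x::'h::complex_inner_space))"
  by (simp add: scaleR_eq_scaleC scaleC_scaleC mult.commute)

lemma scaleC_one: "1 *\<^sub>C x = (x::'h::complex_inner_space)"
  by (metis of_real_1 scaleR_eq_scaleC scaleR_one)

lemma bounded_linear_scaleC: "bounded_linear (\<lambda>x::'h::complex_inner_space. c *\<^sub>C x)"
  by (rule bounded_linear_intro[where K = "cmod c"])
    (simp_all add: scaleC_add_right scaleC_scaleR norm_scaleC mult.commute)

instantiation bop :: (complex_hilbert_space) "{real_algebra,monoid_mult}"
begin
lift_definition zero_bop :: "'a bop" is "\<lambda>_. 0"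
  by (simp add: bounded_ops_def scaleC_zero_right)
lift_definition one_bop :: "'a bop" is "\<lambda>x. x"
  by (simp add: bounded_ops_def)
lift_definition plus_bop :: "'a bop \<Rightarrow> 'a bop \<Rightarrow> 'a bop" is "\<lambda>A B x. A x + B x"
  by (simp add: bounded_ops_def bounded_linear_add scaleC_add_right)
lift_definition minus_bop :: "'a bop \<Rightarrow> 'a bop \<Rightarrow> 'a bop" is "\<lambda>A B x. A x - B x"
  by (simp add: bounded_ops_def bounded_linear_sub scaleC_diff_right)
lift_definition uminus_bop :: "'a bop \<Rightarrow> 'a bop" is "\<lambda>A x. - A x"
  by (simp add: bounded_ops_def bounded_linear_minus scaleC_minus_right)
lift_definition times_bop :: "'a bop \<Rightarrow> 'a bop \<Rightarrow> 'a bop" is "\<lambda>A B x. A (B x)"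
  by (simp add: bounded_ops_def bounded_linear_compose)
lift_definition scaleR_bop :: "real \<Rightarrow> 'a bop \<Rightarrow> 'a bop" is "\<lambda>r A x. r *\<^sub>R A x"
  by (auto simp: bounded_ops_def scaleC_scaleR intro: bounded_linear_const_scaleR)
instance
  by standard
    (rule bop_eqI; simp add: zero_bop.rep_eq one_bop.rep_eq plus_bop.rep_eq minus_bop.rep_eq
      uminus_bop.rep_eq times_bop.rep_eq scaleR_bop.rep_eq oper_add oper_scaleR algebra_simps)+
end

text \<open>The scalar operators.\<close>

lift_definition scal :: "complex \<Rightarrow> ('h::complex_hilbert_space) bop" is "\<lambda>c x. c *\<^sub>C x"
  by (simp add: bounded_ops_def bounded_linear_scaleC scaleC_scaleC mult.commute)

lift_definition star :: "('h::complex_hilbert_space) bop \<Rightarrow> 'h bop" is adj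
  by (metis adj_eqI adj_exists)

lemmas oper_simps = zero_bop.rep_eq one_bop.rep_eq plus_bop.rep_eq minus_bop.rep_eq
      uminus_bop.rep_eq times_bop.rep_eq scaleR_bop.rep_eq scal.rep_eq

lemma cinner_oper: "cinner (oper A x) y = cinner x (oper (star A) y)"
  by transfer (metis adj_eqI adj_exists)

lemma inner_oper: "inner (oper A x) y = inner x (oper (star A) y)"
  by (simp add: inner_eq_Re_cinner cinner_oper)

lemma star_eqI:
  assumes "\<And>x y. inner (oper A x) y = inner x (oper B y)" shows "star A = B"
  by (rule bop_eqI, rule inner_eqI) (metis assms inner_oper)

lemma star_star [simp]: "star (star A) = A"
  by (rule star_eqI) (metis inner_oper inner_commute)

lemma star_mult [simp]: "star (A * B) = star B * star A"
  by (rule star_eqI) (simp add: oper_simps inner_oper)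

lemma star_add [simp]: "star (A + B) = star A + star B"
  by (rule star_eqI) (simp add: oper_simps inner_oper inner_simps)

lemma star_diff [simp]: "star (A - B) = star A - star B"
  by (rule star_eqI) (simp add: oper_simps inner_oper inner_simps)

lemma star_uminus [simp]: "star (- A) = - star A"
  by (rule star_eqI) (simp add: oper_simps inner_oper inner_simps)

lemma star_scaleR [simp]: "star (r *\<^sub>R A) = r *\<^sub>R star A"
  by (rule star_eqI) (simp add: oper_simps inner_oper inner_simps)

lemma star_zero [simp]: "star 0 = 0"
  by (rule star_eqI) (simp add: oper_simps)

lemma star_one [simp]: "star 1 = 1"
  by (rule star_eqI) (simp add: oper_simps)

lemma star_scal [simp]: "star (scal c) = scal (cnj c)"
  by (rule star_eqI) (simp add: oper_simps inner_scaleC_left)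

lemma scal_commute: "A * scal c = scal c * A"
  by (rule bop_eqI) (simp add: oper_simps oper_scaleC)

lemma scal_mult: "scal c * scal d = scal (c * d)"
  by (rule bop_eqI) (simp add: oper_simps scaleC_scaleC)

lemma scal_of_real: "scal (complex_of_real r) = r *\<^sub>R 1"
  by (rule bop_eqI) (simp add: oper_simps scaleR_eq_scaleC)

lemma scal_minus: "scal (- c) = - scal c"
  by (rule bop_eqI) (metis oper_simps(5) scal.rep_eq scaleC_minus_one scaleC_scaleC mult_minus1)

lemma scal_left_commute: "A * (scal c * B) = scal c * (A * B)"
  by (metis mult.assoc scal_commute)

lemma scal_mult_cancel:
  assumes "scal c * A = scal c * B" "c \<noteq> 0" shows "A = B"
proof -
  have "scal (inverse c) * (scal c * D) = D" for D :: "'a bop"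
    unfolding mult.assoc[symmetric] scal_mult using assms(2)
    by (intro bop_eqI) (simp add: oper_simps scaleC_one)
  then show ?thesis using assms(1) by metis
qed

lemma star_mult_self_eq_0: "star A * A = 0 \<Longrightarrow> A = 0"
proof (rule bop_eqI)
  fix x assume "star A * A = 0"
  then have "oper (star A) (oper A x) = 0" by (metis times_bop.rep_eq zero_bop.rep_eq)
  then have "inner (oper A x) (oper A x) = 0" by (simp add: inner_oper[of A x])
  then show "oper A x = oper 0 x" by (simp add: oper_simps)
qed



lemma oper_comp: "oper A \<circ> oper B = oper (A * B)"
  by (simp add: times_bop.rep_eq o_def)

lemma mult_eq_assoc: "A * B = C \<Longrightarrow> A * (B * X) = C * (X::'a::semigroup_mult)"
  by (simp flip: mult.assoc)

lemma bop_bound: obtains C where "C > 0" "\<And>x. norm (oper A x) \<le> C * norm x"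
  using bounded_linear.pos_bounded[OF oper_bounded_linear[of A]] by (metis mult.commute)

text \<open>The commutant of a set of bounded operators.\<close>

definition comm :: "('h::complex_hilbert_space) bop set \<Rightarrow> 'h bop set" where
  "comm S = {T. \<forall>A\<in>S. T * A = A * T}"

text \<open>Von Neumann algebras as sets of elements of the operator type.\<close>

definition vN :: "('h::complex_hilbert_space) bop set \<Rightarrow> bool" where
  "vN M \<longleftrightarrow> (\<forall>A\<in>M. star A \<in> M) \<and> comm (comm M) = M"

lemma commutant_oper: "commutant (oper ` S) = oper ` comm S"
proof (rule set_eqI)
  fix T :: "'a \<Rightarrow> 'a"
  have "T \<in> commutant (oper ` S)" if "T \<in> oper ` comm S"
    using that unfolding commutant_def comm_def
    by (auto simp: oper o_def simp flip: times_bop.rep_eq)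
  moreover have "T \<in> oper ` comm S" if T: "T \<in> commutant (oper ` S)"
  proof -
    have "T \<in> bounded_ops" using T by (simp add: commutant_def)
    then obtain T' where T': "T = oper T'" by (metis Abs_bop_inverse)
    have "T' * A = A * T'" if "A \<in> S" for A
    proof -
      have "T \<circ> oper A = oper A \<circ> T" using T that by (simp add: commutant_def)
      then show ?thesis
        unfolding T' by (intro bop_eqI) (simp add: oper_simps fun_eq_iff)
    qed
    then show ?thesis using T' by (auto simp: comm_def)
  qed
  ultimately show "T \<in> commutant (oper ` S) \<longleftrightarrow> T \<in> oper ` comm S" by blast
qed

lemma adj_oper: "adj (oper A) = oper (star A)" by (simp add: star.rep_eq)

lemma inj_oper: "inj oper" by (simp add: inj_def oper_inject)

lemma vn_algebra_oper: "vn_algebra (oper ` M) \<longleftrightarrow> vN M"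
  unfolding vn_algebra_def vN_def commutant_oper adj_oper ball_simps image_iff
  by (auto simp: oper adj_oper inj_image_eq_iff[OF inj_oper] oper_inject image_iff)

lemma vn_algebra_obtain:
  assumes "vn_algebra M" obtains M' where "M = oper ` M'" "vN M'"
proof -
  have "M \<subseteq> bounded_ops" using assms by (simp add: vn_algebra_def)
  then have "M = oper ` (oper -` M)" by (auto simp: image_iff) (metis Abs_bop_inverse subsetD)
  then show ?thesis using that assms vn_algebra_oper by metis
qed

lemma comm_antimono: "S \<subseteq> T \<Longrightarrow> comm T \<subseteq> comm S" by (auto simp: comm_def)
lemma comm_comm_subset: "S \<subseteq> comm (comm S)" by (auto simp: comm_def)
lemma comm_comm_comm: "comm (comm (comm S)) = comm S"
  by (intro equalityI comm_comm_subset comm_antimono)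

lemma comm_star: "(\<And>A. A \<in> S \<Longrightarrow> star A \<in> S) \<Longrightarrow> T \<in> comm S \<Longrightarrow> star T \<in> comm S"
  unfolding comm_def by (simp, metis star_mult star_star)

lemma vN_comm: "(\<And>A. A \<in> S \<Longrightarrow> star A \<in> S) \<Longrightarrow> vN (comm S)"
  by (simp add: vN_def comm_comm_comm comm_star)

lemma vN_starD: "vN M \<Longrightarrow> A \<in> M \<Longrightarrow> star A \<in> M" by (simp add: vN_def)

lemma
  shows comm_one: "1 \<in> comm S"
    and comm_zero: "0 \<in> comm S"
    and comm_scal: "scal c \<in> comm S"
    and comm_add: "A \<in> comm S \<Longrightarrow> B \<in> comm S \<Longrightarrow> A + B \<in> comm S"
    and comm_diff: "A \<in> comm S \<Longrightarrow> B \<in> comm S \<Longrightarrow> A - B \<in> comm S"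
    and comm_uminus: "A \<in> comm S \<Longrightarrow> - A \<in> comm S"
    and comm_scaleR: "A \<in> comm S \<Longrightarrow> r *\<^sub>R A \<in> comm S"
    and comm_mult: "A \<in> comm S \<Longrightarrow> B \<in> comm S \<Longrightarrow> A * B \<in> comm S"
  by (auto simp: comm_def scal_commute algebra_simps) (metis mult.assoc)

lemmas comm_closed = comm_one comm_zero comm_scal comm_add comm_diff comm_uminus comm_scaleR comm_mult

lemma
  assumes "vN M"
  shows vN_one: "1 \<in> M" and vN_zero: "0 \<in> M" and vN_scal: "scal c \<in> M"
    and vN_add: "A \<in> M \<Longrightarrow> B \<in> M \<Longrightarrow> A + B \<in> M"
    and vN_diff: "A \<in> M \<Longrightarrow> B \<in> M \<Longrightarrow> A - B \<in> M"
    and vN_uminus: "A \<in> M \<Longrightarrow> - A \<in> M"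
    and vN_scaleR: "A \<in> M \<Longrightarrow> r *\<^sub>R A \<in> M"
    and vN_mult: "A \<in> M \<Longrightarrow> B \<in> M \<Longrightarrow> A * B \<in> M"
proof -
  have M: "M = comm (comm M)" using assms by (simp add: vN_def)
  note closed = comm_closed[where S = "comm M", folded M]
  show "1 \<in> M" "0 \<in> M" "scal c \<in> M" by (rule closed)+
  show "A \<in> M \<Longrightarrow> B \<in> M \<Longrightarrow> A + B \<in> M" "A \<in> M \<Longrightarrow> B \<in> M \<Longrightarrow> A - B \<in> M"
    "A \<in> M \<Longrightarrow> - A \<in> M" "A \<in> M \<Longrightarrow> r *\<^sub>R A \<in> M" "A \<in> M \<Longrightarrow> B \<in> M \<Longrightarrow> A * B \<in> M"
    by (fact closed)+
qed

lemmas vN_closed = vN_one vN_zero vN_scal vN_add vN_diff vN_uminus vN_scaleR vN_mult vN_starD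


lemma vN_memI:
  assumes "vN M" and "\<And>T. T \<in> comm M \<Longrightarrow> S * T = T * S"
  shows "S \<in> M"
proof -
  have "S \<in> comm (comm M)" unfolding comm_def[of "comm M"] using assms(2) by blast
  then show ?thesis using assms(1) by (simp add: vN_def)
qed

section \<open>Projections in a von Neumann algebra\<close>

text \<open>Orthogonal projections, that is, self-adjoint idempotents.\<close>

definition projection :: "('h::complex_hilbert_space) bop \<Rightarrow> bool" where
  "projection P \<longleftrightarrow> P * P = P \<and> star P = P"

lemma projection_onto_closed_subspace:
  fixes K :: "('h::complex_hilbert_space) set"
  assumes K: "subspace K" "closed K" and KC: "\<And>c x. x \<in> K \<Longrightarrow> c *\<^sub>C x \<in> K"
  obtains P where "projection P" "\<And>x. oper P x \<in> K" "\<And>x. x \<in> K \<Longrightarrow> oper P x = x"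
proof -
  have "\<exists>p. p \<in> K \<and> (\<forall>k\<in>K. inner (x - p) k = 0)" for x
    by (rule orthogonal_projection_exists[OF K, of x]) auto
  then obtain p where p: "\<And>x. p x \<in> K" "\<And>x k. k \<in> K \<Longrightarrow> inner (x - p x) k = 0"
    by metis
  have uniq: "p x = q" if q: "q \<in> K" "\<And>k. k \<in> K \<Longrightarrow> inner (x - q) k = 0" for x q
  proof -
    have "p x - q \<in> K" using K(1) p(1) q(1) by (rule subspace_diff)
    from p(2)[OF this, of x] q(2)[OF this] have "inner (p x - q) (p x - q) = 0"
      by (simp add: inner_diff_left)
    then show ?thesis by simp
  qed
  have add: "p (x + y) = p x + p y" for x y
    by (rule uniq) (auto intro!: subspace_add[OF K(1)] p(1) simp: add_diff_add inner_add_left p(2))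
  have scale: "p (c *\<^sub>C x) = c *\<^sub>C p x" for c x
    by (rule uniq)
      (auto intro!: KC p(1) simp: p(2) inner_scaleC_left KC simp flip: scaleC_diff_right)
  have "norm (p x) \<le> norm x * 1" for x
  proof (cases "p x = 0")
    case False
    have "norm (p x) * norm (p x) = inner x (p x)"
      using p(2)[OF p(1), of x x] by (simp add: inner_diff_left power2_norm_eq_inner flip: power2_eq_square)
    also have "\<dots> \<le> norm x * norm (p x)" by (rule norm_cauchy_schwarz)
    finally show ?thesis using False by simp
  qed simp
  then have "p \<in> bounded_ops"
    unfolding bounded_ops_def
    by (auto simp: scale add scaleR_eq_scaleC intro!: bounded_linear_intro[where K = 1])
  then obtain P where P: "p = oper P" by (metis Abs_bop_inverse)
  have fix_: "oper P x = x" if "x \<in> K" for x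
    unfolding P[symmetric] by (rule uniq) (use that in auto)
  have sa: "inner (p x) y = inner (p x) (p y)" for x y
    using p(2)[OF p(1)[of x], of y] by (simp add: inner_diff_left inner_diff_right inner_commute[of y "p x"] inner_commute[of "p y" "p x"])
  have "inner (oper P x) y = inner x (oper P y)" for x y
    using sa[of x y] sa[of y x] by (simp add: P inner_commute)
  then have "star P = P" by (rule star_eqI)
  moreover have "P * P = P"
    by (rule bop_eqI) (use fix_[OF p(1)] in \<open>simp add: oper_simps P\<close>)
  ultimately have "projection P" by (simp add: projection_def)
  with that fix_ p(1) show ?thesis by (simp add: P)
qed

text \<open>The projection onto the common kernel of a family of operators in a von Neumann
  algebra lies in the algebra: the kernel is invariant under the commutant. Through the
  algebraic characterisation of its range, kernels, supports and suprema of projections can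
  all be handled by ring calculations.\<close>

lemma kernel_projection:
  assumes M: "vN M" and S: "S \<subseteq> M"
  obtains P where "P \<in> M" "projection P" "\<And>X. P * X = X \<longleftrightarrow> (\<forall>A\<in>S. A * X = 0)"
proof -
  let ?K = "{x. \<forall>A\<in>S. oper A x = 0}"
  have "?K = (\<Inter>A\<in>S. {x. oper A x = 0})" by auto
  moreover have "closed {x. oper A x = 0}" for A :: "'a bop"
    by (intro closed_Collect_eq continuous_on_const
        bounded_linear.continuous_on[OF oper_bounded_linear] continuous_on_id)
  ultimately have "closed ?K" by auto
  moreover have "subspace ?K" by (auto simp: subspace_def oper_zero oper_add oper_scaleR)
  moreover have "c *\<^sub>C x \<in> ?K" if "x \<in> ?K" for c x
    using that by (auto simp: oper_scaleC scaleC_zero_right)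
  ultimately obtain P where P: "projection P" "\<And>x. oper P x \<in> ?K"
    "\<And>x. x \<in> ?K \<Longrightarrow> oper P x = x"
    by (metis (no_types, lifting) projection_onto_closed_subspace)
  have inv: "P * T * P = T * P" if T: "T \<in> comm M" for T
  proof (rule bop_eqI)
    fix x
    have "oper A (oper T (oper P x)) = 0" if "A \<in> S" for A
    proof -
      have "T * A = A * T" using T S that by (auto simp: comm_def)
      then have "oper A (oper T (oper P x)) = oper T (oper A (oper P x))"
        by (metis times_bop.rep_eq)
      then show ?thesis using P(2)[of x] that by (simp add: oper_zero)
    qed
    then show "oper (P * T * P) x = oper (T * P) x"
      by (simp add: times_bop.rep_eq P(3))
  qed
  have "P \<in> M"
  proof (rule vN_memI[OF M])
    fix T assume T: "T \<in> comm M"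
    have "star T \<in> comm M" using M T by (intro comm_star) (auto simp: vN_starD)
    from arg_cong[OF inv[OF this], of star] P(1) have "P * T * P = P * T"
      by (simp add: projection_def mult.assoc)
    then show "P * T = T * P" using inv[OF T] by simp
  qed
  moreover have "P * X = X \<longleftrightarrow> (\<forall>A\<in>S. A * X = 0)" for X
  proof
    assume "P * X = X"
    moreover have "A * P = 0" if "A \<in> S" for A
      using P(2) that by (intro bop_eqI) (auto simp: oper_simps)
    ultimately show "\<forall>A\<in>S. A * X = 0" by (metis mult.assoc mult_zero_left)
  next
    assume X: "\<forall>A\<in>S. A * X = 0"
    have "oper A (oper X x) = 0" if "A \<in> S" for A x
      using X that by (metis times_bop.rep_eq zero_bop.rep_eq)
    then show "P * X = X" by (intro bop_eqI) (simp add: oper_simps P(3))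
  qed
  ultimately show ?thesis using that P(1) by blast
qed

text \<open>In a factor \<open>E M F = 0\<close> only if \<open>E = 0\<close> or \<open>F = 0\<close>: the projection onto the common kernel of
  the operators \<open>E A\<close> with \<open>A\<close> in the algebra is central, hence a scalar.\<close>

lemma factor_prod_eq_0:
  assumes M: "vN M" and cen: "\<And>A. A \<in> M \<Longrightarrow> A \<in> comm M \<Longrightarrow> \<exists>c. A = scal c"
    and E: "E \<in> M" and EF: "\<And>A. A \<in> M \<Longrightarrow> E * A * F = 0"
  shows "E = 0 \<or> F = 0"
proof -
  have "(\<lambda>A. E * A) ` M \<subseteq> M" using E M by (auto intro: vN_mult)
  then obtain P where P: "P \<in> M" "projection P"
    "\<And>X. P * X = X \<longleftrightarrow> (\<forall>A\<in>M. E * A * X = 0)"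
    by (rule kernel_projection[OF M]) auto
  have PB: "P * B * P = B * P" if B: "B \<in> M" for B
  proof -
    have "E * A * (B * P) = 0" if "A \<in> M" for A
    proof -
      have "P * P = P" using P(2) by (simp add: projection_def)
      then have "E * (A * B) * P = 0" using P(3) vN_mult[OF M that B] by blast
      then show ?thesis by (simp add: mult.assoc)
    qed
    then show ?thesis using P(3)[of "B * P"] by (simp add: mult.assoc)
  qed
  have "P * B = B * P" if B: "B \<in> M" for B
    using arg_cong[OF PB[OF vN_starD[OF M B]], of star] PB[OF B] P(2)
    by (simp add: projection_def mult.assoc)
  then obtain c where c: "P = scal c" using cen[OF P(1)] by (auto simp: comm_def)
  have PF: "P * F = F" using P(3) EF by blast
  have "P * P = P" using P(2) by (simp add: projection_def)
  then have "E * 1 * P = 0" using P(3) vN_one[OF M] by blast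
  then have cE: "scal c * E = 0" by (simp add: c scal_commute)
  show ?thesis
  proof (cases "c = 0")
    case True
    then have "P = 0" by (intro bop_eqI) (simp add: c oper_simps)
    then show ?thesis using PF by simp
  next
    case False
    then show ?thesis using cE scal_mult_cancel[of c E 0] by simp
  qed
qed

section \<open>Square roots\<close>

text \<open>The square root is \<open>1 - Y\<close>, where \<open>Y = (B + Y\<^sup>2) / 2\<close> is the limit of the obvious
  iteration from \<open>0\<close>. The increments of the iteration are dominated by those of the scalar
  iteration for \<open>B = 1\<close>, which increases and is bounded by \<open>1\<close>.\<close>

lemma sqrt_one_minus:
  fixes B :: "('h::complex_hilbert_space) bop"
  assumes sa: "star B = B" and B1: "\<And>x. norm (oper B x) \<le> norm x"
  obtains S where "star S = S" "S * S = 1 - B" "\<And>x. 0 \<le> inner (oper S x) x"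
    "\<And>T. T * B = B * T \<Longrightarrow> T * S = S * T"
proof -
  define Y where "Y = rec_nat 0 (\<lambda>_ Y. (1/2) *\<^sub>R (B + Y * Y))"
  define y :: "nat \<Rightarrow> real" where "y = rec_nat 0 (\<lambda>_ y. (1 + y * y) / 2)"
  have Y0: "Y 0 = 0" and YS: "Y (Suc n) = (1/2) *\<^sub>R (B + Y n * Y n)" for n
    by (simp_all add: Y_def)
  have y0: "y 0 = 0" and yS: "y (Suc n) = (1 + y n * y n) / 2" for n
    by (simp_all add: y_def)
  have yb: "0 \<le> y n \<and> y n \<le> 1" for n
    by (induction n) (auto simp: y0 yS intro: mult_le_one)
  have yinc: "y n \<le> y (Suc n)" for n
    using zero_le_square[of "1 - y n"] by (simp add: yS algebra_simps)
  have Ysa: "star (Y n) = Y n" for n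
    by (induction n) (simp_all add: Y0 YS sa)
  have Ycomm: "T * Y n = Y n * T" if T: "T * B = B * T" for T n
  proof (induction n)
    case (Suc n)
    have "T * (Y n * Y n) = Y n * Y n * T" by (metis Suc mult.assoc)
    then show ?case by (simp add: YS algebra_simps T)
  qed (simp add: Y0)
  have YY: "Y n * Y m = Y m * Y n" for n m
    by (rule Ycomm) (simp add: Ycomm)
  have Ybound: "norm (oper (Y n) x) \<le> y n * norm x" for n x
  proof (induction n arbitrary: x)
    case (Suc n)
    have "norm (oper B x + oper (Y n) (oper (Y n) x)) \<le> norm x + y n * (y n * norm x)"
      using B1[of x] Suc[of "oper (Y n) x"] mult_left_mono[OF Suc[of x], of "y n"] yb[of n]
      by (intro norm_triangle_le add_mono) auto
    moreover have "oper (Y (Suc n)) x = (1/2) *\<^sub>R (oper B x + oper (Y n) (oper (Y n) x))"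
      by (simp add: YS oper_simps)
    ultimately show ?case by (simp only: yS norm_scaleR) (simp add: algebra_simps)
  qed (simp add: Y0 y0 oper_simps)
  have Yinc: "norm (oper (Y (Suc n) - Y n) x) \<le> (y (Suc n) - y n) * norm x" for n x
  proof (induction n arbitrary: x)
    case 0
    then show ?case using Ybound[of "Suc 0" x] by (simp add: Y0 y0)
  next
    case (Suc n)
    let ?D = "Y (Suc n) - Y n"
    have "Y (Suc (Suc n)) - Y (Suc n) = (1/2) *\<^sub>R ((Y (Suc n) + Y n) * ?D)"
      using YY[of n "Suc n"] by (simp only: YS[of "Suc n"] YS[of n, symmetric])
         (simp add: YS[of "Suc n"] YS[of n] algebra_simps)
    then have "norm (oper (Y (Suc (Suc n)) - Y (Suc n)) x)
        = (1/2) * norm (oper (Y (Suc n)) (oper ?D x) + oper (Y n) (oper ?D x))"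
      by (simp add: oper_simps)
    also have "\<dots> \<le> (1/2) * (y (Suc n) * norm (oper ?D x) + y n * norm (oper ?D x))"
      by (intro mult_left_mono norm_triangle_le add_mono Ybound) auto
    also have "\<dots> = (1/2) * (y (Suc n) + y n) * norm (oper ?D x)" by (simp add: algebra_simps)
    also have "\<dots> \<le> (1/2) * (y (Suc n) + y n) * ((y (Suc n) - y n) * norm x)"
      using yb[of n] yb[of "Suc n"] by (intro mult_left_mono Suc) auto
    also have "\<dots> = (y (Suc (Suc n)) - y (Suc n)) * norm x"
      by (simp add: yS algebra_simps)
    finally show ?case .
  qed
  have Ydiff: "norm (oper (Y (n + k)) x - oper (Y n) x) \<le> (y (n + k) - y n) * norm x" for n k x
  proof (induction k)
    case (Suc k)
    have "oper (Y (n + Suc k)) x - oper (Y n) x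
        = oper (Y (Suc (n + k)) - Y (n + k)) x + (oper (Y (n + k)) x - oper (Y n) x)"
      by (simp add: oper_simps)
    also have "norm \<dots> \<le> (y (Suc (n + k)) - y (n + k)) * norm x + (y (n + k) - y n) * norm x"
      by (intro norm_triangle_le add_mono Yinc Suc)
    finally show ?case by (simp add: algebra_simps)
  qed simp
  have "incseq y" using yinc by (rule incseq_SucI)
  then have "convergent y" using yb
    by (intro Bseq_mono_convergent BseqI'[where K = 1]) (auto simp: incseq_def)
  then have "Cauchy y" by (simp add: Cauchy_convergent_iff)
  have "Cauchy (\<lambda>n. oper (Y n) x)" for x
  proof (rule metric_CauchyI)
    fix e :: real assume e: "e > 0"
    define d where "d = e / (2 * (norm x + 1))"
    have d: "d > 0" using e by (simp add: d_def add_nonneg_pos)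
    then obtain N where N: "\<And>n m. n \<ge> N \<Longrightarrow> m \<ge> N \<Longrightarrow> dist (y n) (y m) < d"
      using metric_CauchyD[OF \<open>Cauchy y\<close>] by blast
    have half: "dist (oper (Y n) x) (oper (Y N) x) < e / 2" if n: "n \<ge> N" for n
    proof -
      have "dist (oper (Y n) x) (oper (Y N) x) \<le> (y n - y N) * norm x"
        using Ydiff[of N "n - N" x] n by (simp add: dist_norm)
      also have "\<dots> \<le> d * norm x"
        using N[OF n, of N] by (intro mult_right_mono) (auto simp: dist_real_def)
      also have "\<dots> < d * (norm x + 1)" using d by simp
      also have "\<dots> = e / 2"
      proof -
        have "e / (2 * t) * t = e / 2" if "t > 0" for t :: real using that by simp
        moreover have "norm x + 1 > 0" using norm_ge_zero[of x] by linarith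
        ultimately show ?thesis unfolding d_def by blast
      qed
      finally show ?thesis .
    qed
    have "dist (oper (Y n) x) (oper (Y m) x) < e" if "n \<ge> N" "m \<ge> N" for n m
      using dist_triangle2[of "oper (Y n) x" "oper (Y m) x" "oper (Y N) x"]
        half[OF that(1)] half[OF that(2)] by linarith
    then show "\<exists>N. \<forall>m\<ge>N. \<forall>n\<ge>N. dist (oper (Y m) x) (oper (Y n) x) < e" by blast
  qed
  then have "\<exists>l. (\<lambda>n. oper (Y n) x) \<longlonglongrightarrow> l" for x
    by (meson Cauchy_convergent convergent_def)
  then obtain z where z: "\<And>x. (\<lambda>n. oper (Y n) x) \<longlonglongrightarrow> z x" by metis
  have Y1: "norm (oper (Y n) x) \<le> norm x" for n x
    using Ybound[of n x] mult_right_mono[of "y n" 1 "norm x"] yb[of n] by auto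
  have z1: "norm (z x) \<le> norm x" for x
    by (rule LIMSEQ_le_const2[OF tendsto_norm[OF z]]) (use Y1 in auto)
  have zadd: "z (u + v) = z u + z v" for u v
    by (rule LIMSEQ_unique[OF z]) (simp add: oper_add tendsto_add z)
  have zscale: "z (c *\<^sub>C u) = c *\<^sub>C z u" for c u
    by (rule LIMSEQ_unique[OF z])
      (simp add: oper_scaleC bounded_linear.tendsto[OF bounded_linear_scaleC] z)
  have "z \<in> bounded_ops"
    unfolding bounded_ops_def using z1
    by (auto simp: zscale zadd scaleR_eq_scaleC intro!: bounded_linear_intro[where K = 1])
  then obtain Z where Z: "z = oper Z" by (metis Abs_bop_inverse)
  note lim = z[unfolded Z]
  have Zsa: "star Z = Z"
  proof (rule star_eqI)
    fix u v
    have "(\<lambda>n. inner (oper (Y n) u) v) \<longlonglongrightarrow> inner (oper Z u) v"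
      by (intro tendsto_intros lim)
    moreover have "(\<lambda>n. inner (oper (Y n) u) v) \<longlonglongrightarrow> inner u (oper Z v)"
      unfolding inner_oper Ysa by (intro tendsto_intros lim)
    ultimately show "inner (oper Z u) v = inner u (oper Z v)" by (rule LIMSEQ_unique)
  qed
  have Zcomm: "T * Z = Z * T" if T: "T * B = B * T" for T
  proof (rule bop_eqI)
    fix u
    have eq: "oper T (oper (Y n) u) = oper (Y n) (oper T u)" for n
      using Ycomm[OF T, of n] by (metis times_bop.rep_eq)
    have "(\<lambda>n. oper T (oper (Y n) u)) \<longlonglongrightarrow> oper T (oper Z u)"
      by (intro bounded_linear.tendsto[OF oper_bounded_linear] lim)
    then have "oper T (oper Z u) = oper Z (oper T u)"
      unfolding eq by (rule LIMSEQ_unique) (rule lim)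
    then show "oper (T * Z) u = oper (Z * T) u" by (simp add: oper_simps)
  qed
  have fixpoint: "2 *\<^sub>R Z = B + Z * Z"
  proof (rule bop_eqI)
    fix u
    have "(\<lambda>n. oper (Y n) (oper (Y n) u - oper Z u)) \<longlonglongrightarrow> 0"
    proof (rule Lim_null_comparison)
      show "\<forall>\<^sub>F n in sequentially. norm (oper (Y n) (oper (Y n) u - oper Z u)) \<le> norm (oper (Y n) u - oper Z u)"
        by (simp add: Y1)
      show "(\<lambda>n. norm (oper (Y n) u - oper Z u)) \<longlonglongrightarrow> 0"
        using lim[of u] by (simp add: LIM_zero tendsto_norm_zero)
    qed
    from tendsto_add[OF this lim[of "oper Z u"]]
    have "(\<lambda>n. oper (Y n) (oper (Y n) u)) \<longlonglongrightarrow> oper Z (oper Z u)"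
      by (simp add: oper_diff)
    then have "(\<lambda>n. oper B u + oper (Y n) (oper (Y n) u)) \<longlonglongrightarrow> oper B u + oper Z (oper Z u)"
      by (intro tendsto_intros)
    moreover have "(\<lambda>n. 2 *\<^sub>R oper (Y (Suc n)) u) \<longlonglongrightarrow> 2 *\<^sub>R oper Z u"
      by (intro tendsto_intros LIMSEQ_Suc lim)
    ultimately have "2 *\<^sub>R oper Z u = oper B u + oper Z (oper Z u)"
      by (intro LIMSEQ_unique[of "\<lambda>n. 2 *\<^sub>R oper (Y (Suc n)) u"]) (simp_all add: YS oper_simps)
    then show "oper (2 *\<^sub>R Z) u = oper (B + Z * Z) u" by (simp add: oper_simps)
  qed
  show ?thesis
  proof
    show "star (1 - Z) = 1 - Z" by (simp add: Zsa)
    have "(1 - Z) * (1 - Z) = 1 - 2 *\<^sub>R Z + Z * Z" by (simp add: algebra_simps scaleR_2)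
    then show "(1 - Z) * (1 - Z) = 1 - B" by (simp add: fixpoint)
    show "0 \<le> inner (oper (1 - Z) x) x" for x
    proof -
      have "inner (oper Z x) x \<le> norm (oper Z x) * norm x" by (rule norm_cauchy_schwarz)
      also have "\<dots> \<le> norm x * norm x" using z1[of x] by (intro mult_right_mono) (auto simp: Z)
      also have "\<dots> = inner x x" by (simp add: power2_norm_eq_inner flip: power2_eq_square)
      finally show ?thesis by (simp add: oper_simps inner_diff_left)
    qed
    show "T * (1 - Z) = (1 - Z) * T" if "T * B = B * T" for T
      using Zcomm[OF that] by (simp add: algebra_simps)
  qed
qed

text \<open>So \<open>sqrt_one_minus\<close> applies to \<open>B = 1 - A\<^sup>2\<close> and yields a square root of \<open>A\<^sup>2\<close>.\<close>

lemma contraction_one_minus_square: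
  assumes sa: "star A = A" and A1: "\<And>x. norm (oper A x) \<le> norm x"
  shows "norm (oper (1 - A * A) x) \<le> norm x"
proof -
  let ?u = "oper A x"
  have "(norm (oper (1 - A * A) x))\<^sup>2 = inner x x - 2 * inner x (oper A ?u) + inner (oper A ?u) (oper A ?u)"
    by (simp add: power2_norm_eq_inner oper_simps inner_diff_left inner_diff_right inner_commute)
  also have "inner x (oper A ?u) = inner ?u ?u"
    using inner_oper[of A x ?u] by (simp add: sa)
  also have "inner (oper A ?u) (oper A ?u) \<le> inner ?u ?u"
    using power_mono[OF A1[of ?u], of 2] by (simp add: power2_norm_eq_inner)
  finally have "(norm (oper (1 - A * A) x))\<^sup>2 \<le> (norm x)\<^sup>2"
    using inner_ge_zero[of ?u] unfolding power2_norm_eq_inner by linarith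
  then show ?thesis by (rule power2_le_imp_le) simp
qed

lemma contraction_scaleR:
  obtains r where "r > 0" "\<And>x. norm (oper (inverse r *\<^sub>R A) x) \<le> norm x"
proof -
  obtain C where C: "C > 0" "\<And>x. norm (oper A x) \<le> C * norm x" using bop_bound[of A] by blast
  then have "norm (oper (inverse C *\<^sub>R A) x) \<le> norm x" for x
    by (simp add: oper_simps pos_divide_le_eq divide_inverse_commute[symmetric] mult.commute)
  then show ?thesis using that C(1) by blast
qed

text \<open>The last property says that the absolute value lies in every von Neumann algebra that
  contains \<open>A\<^sup>2\<close>.\<close>

lemma absolute_value:
  assumes sa: "star A = A"
  obtains S where "star S = S" "S * S = A * A" "\<And>x. 0 \<le> inner (oper S x) x"
    "\<And>T. T * (A * A) = A * A * T \<Longrightarrow> T * S = S * T"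
proof -
  obtain r where r: "r > 0" "\<And>x. norm (oper (inverse r *\<^sub>R A) x) \<le> norm x"
    using contraction_scaleR[of A] by blast
  let ?A = "inverse r *\<^sub>R A" and ?B = "1 - (inverse r *\<^sub>R A) * (inverse r *\<^sub>R A)"
  have "star ?A = ?A" by (simp add: sa)
  note B1 = contraction_one_minus_square[OF this r(2)]
  have "star ?B = ?B" by (simp add: sa)
  from sqrt_one_minus[OF this B1]
  obtain S where S: "star S = S" "S * S = 1 - ?B" "\<And>x. 0 \<le> inner (oper S x) x"
    "\<And>T. T * ?B = ?B * T \<Longrightarrow> T * S = S * T" by blast
  show ?thesis
  proof
    show "star (r *\<^sub>R S) = r *\<^sub>R S" by (simp add: S(1))
    have "S * S = inverse r *\<^sub>R inverse r *\<^sub>R (A * A)" using S(2) by simp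
    moreover have "r * (r * (inverse r * inverse r)) = 1" using r(1) by (simp add: field_simps)
    ultimately show "(r *\<^sub>R S) * (r *\<^sub>R S) = A * A" by simp
    show "0 \<le> inner (oper (r *\<^sub>R S) x) x" for x
      using S(3)[of x] r(1) by (simp add: oper_simps)
    show "T * (r *\<^sub>R S) = (r *\<^sub>R S) * T" if "T * (A * A) = A * A * T" for T
      using S(4)[of T] that by (simp add: algebra_simps)
  qed
qed

text \<open>A self-adjoint contraction \<open>A\<close> is the real part of the unitary
  \<open>A + \<i> sqrt (1 - A\<^sup>2)\<close>, so the unitaries of a von Neumann algebra have the same commutant
  as the algebra.\<close>

lemma comm_unitaries:
  assumes M: "vN M"
  shows "comm {U \<in> M. star U * U = 1 \<and> U * star U = 1} = comm M" (is "comm ?U = _")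
proof
  show "comm M \<subseteq> comm ?U" by (rule comm_antimono) auto
  have selfadjoint: "X * A = A * X" if X: "X \<in> comm ?U" and A: "A \<in> M" "star A = A" for X A
  proof -
    obtain r where r: "r > 0" "\<And>x. norm (oper (inverse r *\<^sub>R A) x) \<le> norm x"
      using contraction_scaleR[of A] by blast
    define H where "H = inverse r *\<^sub>R A"
    have H: "star H = H" "H \<in> M" "A = r *\<^sub>R H"
      using A r(1) M by (auto simp: H_def vN_scaleR)
    have H1: "norm (oper H x) \<le> norm x" for x using r(2) by (simp add: H_def)
    have HH1: "norm (oper (H * H) x) \<le> norm x" for x
      using order_trans[OF H1 H1] by (simp add: oper_simps)
    have "star (H * H) = H * H" by (simp add: H(1))
    from sqrt_one_minus[OF this HH1]
    obtain S where S: "star S = S" "S * S = 1 - H * H" "\<And>x. 0 \<le> inner (oper S x) x"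
      "\<And>T. T * (H * H) = H * H * T \<Longrightarrow> T * S = S * T" by blast
    have SM: "S \<in> M"
    proof (rule vN_memI[OF M])
      fix T assume "T \<in> comm M"
      then have "T * (H * H) = H * H * T" using vN_mult[OF M H(2) H(2)] by (simp add: comm_def)
      then show "S * T = T * S" by (simp add: S(4))
    qed
    have HS: "H * S = S * H" by (rule S(4)) (simp add: mult.assoc)
    define U where "U = H + scal \<i> * S"
    have sU: "star U = H - scal \<i> * S"
      by (simp add: U_def H(1) S(1) scal_commute scal_minus)
    have "scal \<i> * S * (scal \<i> * S) = - (S * S)"
    proof -
      have "scal \<i> * S * (scal \<i> * S) = scal \<i> * scal \<i> * (S * S)"
        by (metis mult.assoc scal_commute)
      also have "scal \<i> * scal \<i> = - 1"
        unfolding scal_mult by (rule bop_eqI) (simp add: oper_simps scaleC_minus_one)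
      finally show ?thesis by simp
    qed
    moreover have "H * (scal \<i> * S) = scal \<i> * S * H"
      by (metis HS mult.assoc scal_commute)
    ultimately have "star U * U = 1" "U * star U = 1"
      unfolding sU by (simp_all add: U_def algebra_simps S(2))
    moreover have "U \<in> M" using M H(2) SM by (simp add: U_def vN_closed)
    ultimately have "X * U = U * X" "X * star U = star U * X"
      using X M by (auto simp: comm_def vN_starD)
    then have "X * (U + star U) = (U + star U) * X" by (simp add: algebra_simps)
    moreover have "A = (r / 2) *\<^sub>R (U + star U)"
      unfolding sU by (simp add: U_def H(3) flip: scaleR_2)
    ultimately show ?thesis by simp
  qed
  show "comm ?U \<subseteq> comm M"
  proof
    fix X assume X: "X \<in> comm ?U"
    have "X * A = A * X" if A: "A \<in> M" for A
    proof -
      let ?R = "A + star A" and ?I = "scal \<i> * (A - star A)"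
      have "star ?I = ?I" by (simp add: scal_commute scal_minus algebra_simps)
      then have "X * ?I = ?I * X"
        using M A by (intro selfadjoint X) (auto intro!: vN_closed)
      then have "scal \<i> * (X * (A - star A)) = scal \<i> * ((A - star A) * X)"
        by (simp only: scal_left_commute mult.assoc)
      then have I: "X * (A - star A) = (A - star A) * X"
        by (rule scal_mult_cancel) simp
      have R: "X * ?R = ?R * X"
        using M A by (intro selfadjoint X) (auto intro!: vN_closed simp: add.commute)
      have "X * ?R + X * (A - star A) = ?R * X + (A - star A) * X" using I R by simp
      then have "2 *\<^sub>R (X * A) = 2 *\<^sub>R (A * X)" by (simp add: algebra_simps scaleR_2)
      then show ?thesis by simp
    qed
    then show "X \<in> comm M" by (simp add: comm_def)
  qed
qed


section \<open>Halving projections\<close>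

lemma absolute_value_mem:
  assumes M: "vN M" and A: "A \<in> M" "star A = A"
  obtains S where "S \<in> M" "star S = S" "S * S = A * A" "\<And>x. 0 \<le> inner (oper S x) x"
    "\<And>T. T * (A * A) = A * A * T \<Longrightarrow> T * S = S * T" "\<And>R. A * R = A \<Longrightarrow> S * R = S"
proof -
  obtain S where S: "star S = S" "S * S = A * A" "\<And>x. 0 \<le> inner (oper S x) x"
    "\<And>T. T * (A * A) = A * A * T \<Longrightarrow> T * S = S * T"
    using absolute_value[OF A(2)] by blast
  have "S \<in> M"
  proof (rule vN_memI[OF M])
    fix T assume "T \<in> comm M"
    then have "T * (A * A) = A * A * T" using vN_mult[OF M A(1) A(1)] by (simp add: comm_def)
    then show "S * T = T * S" by (simp add: S(4))
  qed
  moreover have "S * R = S" if AR: "A * R = A" for R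
  proof -
    have "star (S * (1 - R)) * (S * (1 - R)) = star (1 - R) * ((S * S) * (1 - R))"
      by (simp only: star_mult S(1) mult.assoc)
    also have "\<dots> = 0" by (simp add: S(2) algebra_simps AR)
    finally have "S * (1 - R) = 0" by (rule star_mult_self_eq_0)
    then show ?thesis by (simp add: algebra_simps)
  qed
  ultimately show ?thesis using that S by blast
qed

text \<open>The complement of the projection onto a common kernel. For one self-adjoint operator it is
  the support, for a family of projections the supremum.\<close>

lemma support_projection:
  assumes M: "vN M" and S: "S \<subseteq> M"
  obtains E where "E \<in> M" "projection E" "\<And>X. E * X = 0 \<longleftrightarrow> (\<forall>A\<in>S. A * X = 0)"
    "\<And>A. A \<in> S \<Longrightarrow> A * E = A"
proof -
  obtain P where P: "P \<in> M" "projection P" "\<And>X. P * X = X \<longleftrightarrow> (\<forall>A\<in>S. A * X = 0)"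
    using kernel_projection[OF M S] by blast
  show ?thesis
  proof
    show "1 - P \<in> M" using M P(1) by (simp add: vN_closed)
    show "projection (1 - P)" using P(2) by (simp add: projection_def algebra_simps)
    show iff: "(1 - P) * X = 0 \<longleftrightarrow> (\<forall>A\<in>S. A * X = 0)" for X
      using P(3)[of X] by (auto simp: algebra_simps)
    show "A * (1 - P) = A" if "A \<in> S" for A
      using P(2) P(3)[of P] that by (simp add: projection_def algebra_simps)
  qed
qed

lemma projectionD:
  assumes "projection P"
  shows "P * P = P" "star P = P" "P * (P * X) = P * X"
  using assms by (simp_all add: projection_def flip: mult.assoc)

lemma projection_diff:
  assumes "projection R" "projection P" "R * P = P"
  shows "projection (R - P)" "P * R = P"
proof -
  show PR: "P * R = P" using arg_cong[OF assms(3), of star] assms(1,2) by (simp add: projectionD)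
  show "projection (R - P)"
    unfolding projection_def using assms PR by (simp add: projectionD algebra_simps)
qed

text \<open>If \<open>R\<close> has no proper subprojection in \<open>M\<close>, then \<open>R M R\<close> consists of multiples of \<open>R\<close>. For
  self-adjoint \<open>A\<close> in \<open>R M R\<close>, the kernel of \<open>S - A\<close> below \<open>R\<close>, where \<open>S\<close> is the absolute value, is
  trivial, so \<open>A\<close> is \<open>S\<close> or \<open>- S\<close> and cannot take values of both signs. The same holds for
  every \<open>A - r R\<close>, which forces the quadratic form of \<open>A\<close> to be constant on unit vectors.\<close>

lemma minimal_projection_corner:
  assumes M: "vN M" and R: "R \<in> M" "projection R"
    and min: "\<And>P. P \<in> M \<Longrightarrow> projection P \<Longrightarrow> R * P = P \<Longrightarrow> P = 0 \<or> P = R"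
    and A: "A \<in> M"
  shows "\<exists>c. R * A * R = scal c * R"
proof -
  have definite: "(\<forall>x. 0 \<le> inner (oper A x) x) \<or> (\<forall>x. inner (oper A x) x \<le> 0)"
    if A: "A \<in> M" "star A = A" "R * A = A" for A
  proof -
    have AR: "A * R = A" using arg_cong[OF A(3), of star] R(2) A(2) by (simp add: projectionD)
    obtain S where SM: "S \<in> M" and S: "star S = S" "S * S = A * A" "\<And>x. 0 \<le> inner (oper S x) x"
      "\<And>T. T * (A * A) = A * A * T \<Longrightarrow> T * S = S * T" "\<And>R. A * R = A \<Longrightarrow> S * R = S"
      using absolute_value_mem[OF M A(1,2)] by blast
    have SR: "S * R = S" by (rule S(5)[OF AR])
    have RS: "R * S = S" using arg_cong[OF SR, of star] R(2) S(1) by (simp add: projectionD)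
    have "{S - A, 1 - R} \<subseteq> M" using M R(1) SM A(1) by (simp add: vN_closed)
    from kernel_projection[OF M this] obtain P where P: "P \<in> M" "projection P"
      "\<And>X. P * X = X \<longleftrightarrow> (\<forall>A\<in>{S - A, 1 - R}. A * X = 0)" by blast
    have "P * P = P" using P(2) by (rule projectionD)
    then have "(S - A) * P = 0" "(1 - R) * P = 0" using P(3)[of P] by auto
    then have "R * P = P" by (simp add: algebra_simps)
    from min[OF P(1,2) this] show ?thesis
    proof
      assume "P = 0"
      have "A * S = S * A" by (rule S(4)) (simp add: mult.assoc)
      then have "P * (S + A) = S + A"
        unfolding P(3) by (simp add: algebra_simps RS A(3) S(2))
      then have "A = - S" using \<open>P = 0\<close> by (simp add: eq_neg_iff_add_eq_0 add.commute)
      then show ?thesis using S(3) by (simp add: oper_simps)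
    next
      assume "P = R"
      then have "A = S" using \<open>(S - A) * P = 0\<close> by (simp add: algebra_simps SR AR)
      then show ?thesis using S(3) by simp
    qed
  qed
  have selfadjoint: "\<exists>r. A = r *\<^sub>R R" if A: "A \<in> M" "star A = A" "R * A = A" for A
  proof (cases "R = 0")
    case False
    have AR: "A * R = A" using arg_cong[OF A(3), of star] R(2) A(2) by (simp add: projectionD)
    let ?q = "\<lambda>x. inner (oper A x) x / inner x x"
    have q: "?q x = ?q y" if xy: "oper R x = x" "oper R y = y" "x \<noteq> 0" "y \<noteq> 0" for x y
    proof -
      \<comment> \<open>If \<open>?q x\<close> and \<open>?q y\<close> differed, \<open>A - r R\<close> would be indefinite.\<close>
      define r where "r = (?q x + ?q y) / 2"
      define B where "B = A - r *\<^sub>R R"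
      have B: "B \<in> M" "star B = B" "R * B = B"
        using A R M by (auto simp: B_def vN_closed projectionD algebra_simps)
      have "inner (oper B z) z = (?q z - r) * inner z z" if "oper R z = z" "z \<noteq> 0" for z
        using that by (simp add: B_def oper_simps inner_diff_left algebra_simps)
      from this[of x] this[of y] xy
      have "inner (oper B x) x = (?q x - ?q y) / 2 * inner x x"
        "inner (oper B y) y = (?q y - ?q x) / 2 * inner y y"
        by (simp_all add: r_def field_simps)
      moreover have "inner x x > 0" "inner y y > 0" using xy by auto
      moreover have "inner (oper B x) x \<ge> 0 \<and> inner (oper B y) y \<ge> 0 \<or>
          inner (oper B x) x \<le> 0 \<and> inner (oper B y) y \<le> 0"
        using definite[OF B] by blast
      moreover have "a = b" if "u = (a - b) / 2 * m" "v = (b - a) / 2 * n" "m > 0" "n > 0"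
        "u \<ge> 0 \<and> v \<ge> 0 \<or> u \<le> 0 \<and> v \<le> 0" for a b u v m n :: real
        using that(5) unfolding that(1,2) using that(3,4)
        by (auto simp: zero_le_mult_iff mult_le_0_iff)
      ultimately show ?thesis by blast
    qed
    from False obtain x0 where x0: "oper R x0 \<noteq> 0"
      using bop_eqI[of R 0] by (auto simp: oper_simps)
    define r where "r = ?q (oper R x0)"
    define B where "B = A - r *\<^sub>R R"
    have B: "star B = B" "B * R = B"
      using A(2) R AR by (auto simp: B_def projectionD algebra_simps)
    have RR: "oper R (oper R x) = oper R x" for x
      using R(2) by (metis projectionD(1) times_bop.rep_eq)
    have 0: "inner (oper B x) x = 0" if "oper R x = x" for x
    proof (cases "x = 0")
      case False
      then have "?q x = r" unfolding r_def using that x0 by (intro q) (simp_all add: RR)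
      then show ?thesis using that False
        by (simp add: B_def oper_simps inner_diff_left field_simps)
    qed (simp add: oper_zero)
    have RB: "R * B = B" using A R by (auto simp: B_def projectionD algebra_simps)
    have "oper B x = 0" for x
    proof -
      let ?u = "oper R x"
      let ?v = "oper B ?u"
      have v: "oper R ?v = ?v" using RB by (metis times_bop.rep_eq)
      have "inner (oper B (?u + ?v)) (?u + ?v) = 0"
        by (rule 0) (simp add: oper_add RR v)
      moreover have "inner (oper B ?v) ?u = inner ?v ?v"
        using inner_oper[of B ?v ?u] by (simp add: B(1))
      ultimately have "inner ?v ?v = 0"
        using 0[OF RR] 0[OF v] by (simp add: oper_add inner_simps)
      then have "?v = 0" by simp
      then show ?thesis using B(2) by (metis times_bop.rep_eq)
    qed
    then have "B = 0" by (intro bop_eqI) (simp add: oper_simps)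
    then show ?thesis by (auto simp: B_def)
  qed (use A in auto)
  define C where "C = R * A * R"
  have C: "C \<in> M" "star C \<in> M" "R * C = C" "R * star C = star C"
    using M R A by (auto simp: C_def vN_closed projectionD mult.assoc)
  obtain r where r: "C + star C = r *\<^sub>R R"
    using selfadjoint[of "C + star C"] C M by (auto simp: vN_closed distrib_left add.commute)
  obtain s where s: "scal \<i> * (C - star C) = s *\<^sub>R R"
  proof -
    have "scal \<i> * (C - star C) \<in> M" using C M by (intro vN_closed) auto
    moreover have "star (scal \<i> * (C - star C)) = scal \<i> * (C - star C)"
      by (simp add: scal_commute scal_minus algebra_simps)
    moreover have "R * (scal \<i> * (C - star C)) = scal \<i> * (C - star C)"
      unfolding scal_left_commute right_diff_distrib C ..
    ultimately show ?thesis using selfadjoint that by blast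
  qed
  have "C - star C = scal (- \<i> * of_real s) * R"
  proof -
    have "scal \<i> * (C - star C) = scal \<i> * (scal (- \<i> * of_real s) * R)"
      unfolding s mult.assoc[symmetric] scal_mult by (simp add: scal_of_real)
    then show ?thesis by (rule scal_mult_cancel) simp
  qed
  moreover have "C + star C = scal (of_real r) * R" unfolding r by (simp add: scal_of_real)
  ultimately have "(C + star C) + (C - star C) = (scal (of_real r) + scal (- \<i> * of_real s)) * R"
    by (simp add: distrib_right)
  also have "scal (of_real r) + scal (- \<i> * of_real s) = scal (of_real r - \<i> * of_real s)"
    by (rule bop_eqI) (simp add: oper_simps flip: scaleC_add_left)
  also have "(C + star C) + (C - star C) = scal 2 * C"
    using scal_of_real[of 2, where 'a = 'a] by (simp add: scaleR_2 distrib_right)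
  finally have "scal 2 * C = scal 2 * (scal ((of_real r - \<i> * of_real s) / 2) * R)"
    by (simp only: mult.assoc[symmetric] scal_mult times_divide_eq_right
        nonzero_mult_div_cancel_left[OF zero_neq_numeral[symmetric]])
  then have "C = scal ((of_real r - \<i> * of_real s) / 2) * R" by (rule scal_mult_cancel) simp
  then show ?thesis unfolding C_def by blast
qed

lemma half_add:
  fixes x y :: "'a::real_vector"
  shows "(1/2) *\<^sub>R x + (1/2) *\<^sub>R x = x" "(1/2) *\<^sub>R x + ((1/2) *\<^sub>R x + y) = x + y"
  by (simp_all flip: scaleR_2 add.assoc)

text \<open>Two projections at angle \<open>\<pi>/4\<close>. With respect to \<open>E \<or> G\<close> the projection
  \<open>E\<close> has a complement equivalent to it, and \<open>2 G E - E\<close> is a partial isometry between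
  the two. In contrast to the partial isometry, the pair consists of projections only, of which
  orthogonal families have a supremum.\<close>

definition half_angle :: "('h::complex_hilbert_space) bop \<Rightarrow> 'h bop \<Rightarrow> bool" where
  "half_angle E G \<longleftrightarrow> projection E \<and> projection G \<and>
     E * G * E = (1/2) *\<^sub>R E \<and> G * E * G = (1/2) *\<^sub>R G"

lemma half_angleD:
  assumes "half_angle E G"
  shows "projection E" "projection G"
    "E * (G * E) = (1/2) *\<^sub>R E" "G * (E * G) = (1/2) *\<^sub>R G"
    "E * (G * (E * X)) = (1/2) *\<^sub>R (E * X)" "G * (E * (G * X)) = (1/2) *\<^sub>R (G * X)"
  using assms unfolding half_angle_def by (simp_all add: mult.assoc)
    (metis mult.assoc mult_scaleR_left)+

lemma half_angle_partial_isometry: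
  assumes h: "half_angle E G"
  defines "V \<equiv> 2 *\<^sub>R (G * E) - E"
  defines "Q \<equiv> star V * V + V * star V"
  shows "star V * V = E" "V * V = 0" "Q * E = E" "Q * G = G" "projection Q"
    "\<And>R. R * E = E \<Longrightarrow> R * G = G \<Longrightarrow> R * Q = Q"
proof -
  note [simp] = half_angleD[OF h] projectionD[OF half_angleD(1)[OF h]] projectionD[OF half_angleD(2)[OF h]]
  show "star V * V = E"
    by (simp add: V_def algebra_simps scaleR_2)
  then have Q: "Q = 2 *\<^sub>R (E + G - G * E - E * G)"
    unfolding Q_def by (simp add: V_def algebra_simps scaleR_2 half_add)
  show "V * V = 0" by (simp add: V_def algebra_simps scaleR_2 half_add)
  show QE: "Q * E = E" by (simp add: Q algebra_simps scaleR_2 half_add)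
  show QG: "Q * G = G" by (simp add: Q algebra_simps scaleR_2 half_add)
  have "Q * Q = 2 *\<^sub>R (Q * E + Q * G - Q * G * E - Q * E * G)"
    by (subst (2) Q) (simp only: mult_scaleR_right distrib_left right_diff_distrib mult.assoc)
  then have "Q * Q = Q" by (simp only: QE QG Q[symmetric])
  then show "projection Q" unfolding projection_def by (simp add: Q algebra_simps)
  show "R * Q = Q" if "R * E = E" "R * G = G" for R
    by (simp add: Q algebra_simps that mult_eq_assoc[OF that(1)] mult_eq_assoc[OF that(2)])
qed

text \<open>A von Neumann algebra with trivial center and without nonzero abelian projections, so a
  factor of type II or III, or the algebra on the zero space.\<close>

locale continuous_factor =
  fixes M :: "('h::complex_hilbert_space) bop set"
  assumes vN: "vN M"
    and center: "A \<in> M \<Longrightarrow> A \<in> comm M \<Longrightarrow> \<exists>c. A = scal c"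
    and no_abelian: "P \<in> M \<Longrightarrow> projection P \<Longrightarrow>
      (\<And>A B. A \<in> M \<Longrightarrow> B \<in> M \<Longrightarrow> P * A * P * (P * B * P) = P * B * P * (P * A * P)) \<Longrightarrow> P = 0"
begin

lemmas closed = vN_one[OF vN] vN_zero[OF vN] vN_add[OF vN] vN_diff[OF vN] vN_uminus[OF vN]
  vN_scaleR[OF vN] vN_mult[OF vN] vN_starD[OF vN]

lemma proper_subprojection:
  assumes R: "R \<in> M" "projection R" "R \<noteq> 0"
  obtains P where "P \<in> M" "projection P" "R * P = P" "P \<noteq> 0" "P \<noteq> R"
proof (rule ccontr)
  note witness = that
  assume "\<not> thesis"
  then have min: "P = 0 \<or> P = R" if "P \<in> M" "projection P" "R * P = P" for P
    using that witness by blast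
  have "R = 0"
  proof (rule no_abelian[OF R(1,2)])
    fix A B assume "A \<in> M" "B \<in> M"
    then obtain c d where "R * A * R = scal c * R" "R * B * R = scal d * R"
      using minimal_projection_corner[OF vN R(1,2) min] by metis
    then show "R * A * R * (R * B * R) = R * B * R * (R * A * R)"
      by (metis mult.assoc scal_commute)
  qed
  then show False using R(3) by simp
qed

text \<open>For a self-adjoint \<open>Y\<close> that is off-diagonal with respect to \<open>P\<close> and \<open>R - P\<close>, the
  symmetry \<open>J = 2 P - R\<close> exchanges the supports \<open>G\<close> and \<open>H\<close> of the positive and the negative
  part of \<open>Y\<close>. So \<open>G\<close> makes the angle \<open>\<pi>/4\<close> with \<open>P (G + H)\<close>.\<close>

lemma half_angle_below:
  assumes R: "R \<in> M" "projection R" "R \<noteq> 0"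
  obtains E G where "E \<in> M" "G \<in> M" "half_angle E G" "E \<noteq> 0" "R * E = E" "R * G = G"
proof -
  obtain P where P: "P \<in> M" "projection P" "R * P = P" "P \<noteq> 0" "P \<noteq> R"
    using proper_subprojection[OF R] .
  define T where "T = R - P"
  have T: "T \<in> M" "projection T" "T \<noteq> 0"
    using R P projection_diff[OF R(2) P(2,3)] by (auto simp: T_def closed)
  have PR: "P * R = P" using projection_diff[OF R(2) P(2,3)] by simp
  obtain A where A: "A \<in> M" "P * A * T \<noteq> 0"
    using factor_prod_eq_0[OF vN center P(1)] P(4) T(3) by metis
  define X where "X = P * A * T"
  define Y where "Y = X + star X"
  define J where "J = P - T"
  note s = projectionD[OF P(2)] projectionD[OF R(2)] P(3) PR
    mult_eq_assoc[OF P(3)] mult_eq_assoc[OF PR]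
  have J: "star J = J" "J * J = R" "R * J = J" "J * R = J" "P = (1/2) *\<^sub>R (R + J)"
    by (simp_all add: J_def T_def s algebra_simps flip: scaleR_2)
  have Y: "Y \<in> M" "star Y = Y" using A P T by (auto simp: Y_def X_def closed add.commute)
  have JY: "J * Y = - (Y * J)" and RY: "R * Y = Y"
    by (simp_all add: Y_def X_def J_def T_def s algebra_simps)
  have "P * Y * T = X" by (simp add: Y_def X_def T_def s algebra_simps)
  then have Y0: "Y \<noteq> 0" using A by (auto simp: X_def)
  have YR: "Y * R = Y" using arg_cong[OF RY, of star] by (simp add: Y s)
  obtain S where SM: "S \<in> M" and S: "star S = S" "S * S = Y * Y" "\<And>x. 0 \<le> inner (oper S x) x"
      "\<And>T. T * (Y * Y) = Y * Y * T \<Longrightarrow> T * S = S * T" "\<And>R. Y * R = Y \<Longrightarrow> S * R = S"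
    using absolute_value_mem[OF vN Y] by blast
  have SR: "S * R = S" by (rule S(5)[OF YR])
  have YS: "Y * S = S * Y" by (rule S(4)) (simp add: mult.assoc)
  have JS: "J * S = S * J"
    by (rule S(4)) (simp add: JY mult_eq_assoc[OF JY] mult.assoc)
  have SY: "{S + Y} \<subseteq> M" "{S - Y} \<subseteq> M" using SM Y by (auto simp: closed)
  obtain G where
    G: "G \<in> M" "projection G" "\<And>X. G * X = 0 \<longleftrightarrow> (S + Y) * X = 0" "(S + Y) * G = S + Y"
    by (rule support_projection[OF vN SY(1)]) simp
  obtain H where
    H: "H \<in> M" "projection H" "\<And>X. H * X = 0 \<longleftrightarrow> (S - Y) * X = 0" "(S - Y) * H = S - Y"
    by (rule support_projection[OF vN SY(2)]) simp
  note s' = projectionD[OF G(2)] projectionD[OF H(2)]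
  have "G * (S - Y) = 0" unfolding G(3) by (simp add: algebra_simps S(2) YS)
  from arg_cong[OF this, of star] have "(S - Y) * G = 0" by (simp add: S(1) Y(2) s')
  then have HG: "H * G = 0" by (simp add: H(3))
  from arg_cong[OF this, of star] have GH: "G * H = 0" by (simp add: s')
  have "G * (1 - R) = 0" unfolding G(3) by (simp add: algebra_simps SR YR)
  then have GR: "G * R = G" by (simp add: algebra_simps)
  have RG: "R * G = G" using arg_cong[OF GR, of star] by (simp add: s s')
  have "H * (1 - R) = 0" unfolding H(3) by (simp add: algebra_simps SR YR)
  then have HR: "H * R = H" by (simp add: algebra_simps)
  have RH: "R * H = H" using arg_cong[OF HR, of star] by (simp add: s s')
  have "G * (J * (1 - H)) = 0"
  proof -
    have "(S + Y) * J = J * (S - Y)" by (simp add: algebra_simps JS JY)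
    then have "(S + Y) * (J * (1 - H)) = J * ((S - Y) * (1 - H))" by (metis mult.assoc)
    also have "(S - Y) * (1 - H) = 0" using H(4) by (simp add: right_diff_distrib)
    finally show ?thesis by (simp add: G(3))
  qed
  then have GJ: "G * J = G * (J * H)" by (simp add: algebra_simps)
  have "H * (J * (1 - G)) = 0"
  proof -
    have "(S - Y) * J = J * (S + Y)" by (simp add: algebra_simps JS JY)
    then have "(S - Y) * (J * (1 - G)) = J * ((S + Y) * (1 - G))" by (metis mult.assoc)
    also have "(S + Y) * (1 - G) = 0" using G(4) by (simp add: right_diff_distrib)
    finally show ?thesis by (simp add: H(3))
  qed
  then have HJ: "H * J = H * (J * G)" by (simp add: algebra_simps)
  have JH: "J * H = G * J"
    using arg_cong[OF HJ, of star] by (simp add: J s' GJ mult.assoc)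
  have JG: "J * G = H * J"
    using arg_cong[OF GJ, of star] by (simp add: J s' HJ mult.assoc)
  define E where "E = P * (G + H)"
  note t = s' HG GH GR RG HR RH J(2-4) JH JG
  note t' = t mult_eq_assoc[OF HG] mult_eq_assoc[OF GH] mult_eq_assoc[OF GR] mult_eq_assoc[OF RG]
    mult_eq_assoc[OF HR] mult_eq_assoc[OF RH] mult_eq_assoc[OF J(2)] mult_eq_assoc[OF J(3)]
    mult_eq_assoc[OF J(4)] mult_eq_assoc[OF JH] mult_eq_assoc[OF JG]
    projectionD(1,3)[OF R(2)]
  have E: "E = (1/2) *\<^sub>R (G + H + G * J + H * J)"
    by (simp add: E_def J(5) t' algebra_simps)
  have "half_angle E G"
    unfolding half_angle_def projection_def
    by (simp add: E t' J(1) algebra_simps G(2)[unfolded projection_def] flip: scaleR_2)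
  moreover have "G \<noteq> 0"
  proof
    assume "G = 0"
    then have "S = - Y" using G(4) by (simp add: eq_neg_iff_add_eq_0)
    then have "J * Y = Y * J" using JS by simp
    moreover have "J * Y + Y * J = 0" by (simp add: JY)
    ultimately have "2 *\<^sub>R (J * Y) = 0" by (simp add: scaleR_2)
    then have "J * (J * Y) = 0" by simp
    then show False using Y0 by (simp add: mult_eq_assoc[OF J(2)] RY)
  qed
  moreover from this have "E \<noteq> 0" using calculation(1) by (auto simp: half_angle_def)
  moreover have "R * E = E" by (simp add: E t' algebra_simps)
  moreover have "E \<in> M" using P G H by (simp add: E_def closed)
  ultimately show ?thesis using that G(1) RG by blast
qed

text \<open>A maximal orthogonal family of pairs at angle \<open>\<pi>/4\<close> below \<open>R\<close> is chosen by Zorn's lemma.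
  The suprema \<open>E\<close> and \<open>G\<close> of its two components are again at angle \<open>\<pi>/4\<close>. If \<open>E \<or> G\<close> were not
  \<open>R\<close>, a pair below the difference would enlarge the family.\<close>

lemma halving:
  assumes R: "R \<in> M" "projection R"
  obtains V where "V \<in> M" "V * V = 0" "star V * V + V * star V = R" "projection (star V * V)"
proof -
  define blocks where "blocks = {(E, G). E \<in> M \<and> G \<in> M \<and> half_angle E G \<and> E \<noteq> 0 \<and> R * E = E \<and> R * G = G}"
  define orth :: "'h bop \<times> 'h bop \<Rightarrow> 'h bop \<times> 'h bop \<Rightarrow> bool" where
    "orth = (\<lambda>(E, G) (E', G'). E * E' = 0 \<and> E * G' = 0 \<and> G * E' = 0 \<and> G * G' = 0)"
  let ?A = "{F. F \<subseteq> blocks \<and> (\<forall>b\<in>F. \<forall>b'\<in>F. b \<noteq> b' \<longrightarrow> orth b b')}"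
  have "\<exists>F\<in>?A. \<forall>X\<in>?A. F \<subseteq> X \<longrightarrow> X = F"
  proof (rule subset_Zorn')
    fix C assume C: "subset.chain ?A C"
    have "orth b b'" if bb: "b \<in> \<Union>C" "b' \<in> \<Union>C" "b \<noteq> b'" for b b'
    proof -
      obtain X X' where X: "X \<in> C" "X' \<in> C" "b \<in> X" "b' \<in> X'" using bb by blast
      then have "X \<subseteq> X' \<or> X' \<subseteq> X" using C by (auto simp: subset_chain_def)
      then obtain X'' where "X'' \<in> C" "b \<in> X''" "b' \<in> X''" using X by blast
      then show ?thesis using C bb(3) by (auto simp: subset_chain_def)
    qed
    then show "\<Union>C \<in> ?A" using C by (auto simp: subset_chain_def)
  qed
  then obtain F where FA: "F \<in> ?A" and max: "\<forall>X\<in>?A. F \<subseteq> X \<longrightarrow> X = F" by (elim bexE)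
  have F: "F \<subseteq> blocks" "\<And>b b'. b \<in> F \<Longrightarrow> b' \<in> F \<Longrightarrow> b \<noteq> b' \<Longrightarrow> orth b b'"
    using FA by blast+
  have "fst ` F \<subseteq> M" "snd ` F \<subseteq> M" using F(1) by (auto simp: blocks_def)
  note FM = this
  obtain E where
    E: "E \<in> M" "projection E" "\<And>X. E * X = 0 \<longleftrightarrow> (\<forall>A\<in>fst ` F. A * X = 0)"
      "\<And>A. A \<in> fst ` F \<Longrightarrow> A * E = A"
    using support_projection[OF vN FM(1)] by blast
  obtain G where
    G: "G \<in> M" "projection G" "\<And>X. G * X = 0 \<longleftrightarrow> (\<forall>A\<in>snd ` F. A * X = 0)"
      "\<And>A. A \<in> snd ` F \<Longrightarrow> A * G = A"
    using support_projection[OF vN FM(2)] by blast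
  \<comment> \<open>The suprema act on each member of the family like its own two components.\<close>
  have b: "half_angle e g" "R * e = e" "R * g = g" "e * E = e" "g * G = g" "E * e = e" "G * g = g"
    "E * g = e * g" "G * e = g * e" if eg: "(e, g) \<in> F" for e g
  proof -
    show h: "half_angle e g" "R * e = e" "R * g = g" using F(1) eg by (auto simp: blocks_def)
    show e: "e * E = e" using E(4) eg by force
    show g: "g * G = g" using G(4) eg by force
    note p = half_angleD[OF h(1)]
    show Ee: "E * e = e" using arg_cong[OF e, of star] by (simp add: projectionD p(1) E(2))
    show Gg: "G * g = g" using arg_cong[OF g, of star] by (simp add: projectionD p(2) G(2))
    have "e' * (g - e * g) = 0" if "(e', g') \<in> F" for e' g'
    proof (cases "(e', g') = (e, g)")
      case True then show ?thesis by (simp add: algebra_simps projectionD p(1))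
    next
      case False
      from F(2)[OF that eg False] show ?thesis
        by (simp add: orth_def algebra_simps mult_eq_assoc[of e' e])
    qed
    then have "E * (g - e * g) = 0" unfolding E(3) by auto
    then show "E * g = e * g" by (simp add: algebra_simps mult_eq_assoc[OF Ee])
    have "g' * (e - g * e) = 0" if "(e', g') \<in> F" for e' g'
    proof (cases "(e', g') = (e, g)")
      case True then show ?thesis by (simp add: algebra_simps projectionD p(2))
    next
      case False
      from F(2)[OF that eg False] show ?thesis
        by (simp add: orth_def algebra_simps mult_eq_assoc[of g' g])
    qed
    then have "G * (e - g * e) = 0" unfolding G(3) by auto
    then show "G * e = g * e" by (simp add: algebra_simps mult_eq_assoc[OF Gg])
  qed
  have "R * E = E"
  proof -
    have "E * (1 - R) = 0"
      unfolding E(3)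
    proof clarify
      fix e g assume eg: "(e, g) \<in> F"
      have "e * R = e" using arg_cong[OF b(2)[OF eg], of star] half_angleD[OF b(1)[OF eg]] R
        by (simp add: projectionD)
      then show "fst (e, g) * (1 - R) = 0" by (simp add: algebra_simps)
    qed
    then have "E * R = E" by (simp add: algebra_simps)
    from arg_cong[OF this, of star] show ?thesis using E(2) R by (simp add: projectionD)
  qed
  have "R * G = G"
  proof -
    have "G * (1 - R) = 0"
      unfolding G(3)
    proof clarify
      fix e g assume eg: "(e, g) \<in> F"
      have "g * R = g" using arg_cong[OF b(3)[OF eg], of star] half_angleD[OF b(1)[OF eg]] R
        by (simp add: projectionD)
      then show "snd (e, g) * (1 - R) = 0" by (simp add: algebra_simps)
    qed
    then have "G * R = G" by (simp add: algebra_simps)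
    from arg_cong[OF this, of star] show ?thesis using G(2) R by (simp add: projectionD)
  qed
  have "E * G * E = (1/2) *\<^sub>R E"
  proof -
    let ?T = "E * G * E - (1/2) *\<^sub>R E"
    have sT: "star ?T = ?T" using E(2) G(2) by (simp add: projectionD mult.assoc)
    have "e * ?T = 0" if eg: "(e, g) \<in> F" for e g
    proof -
      have "?T * e = 0"
        by (simp add: algebra_simps b[OF eg] half_angleD[OF b(1)[OF eg]] mult_eq_assoc[OF b(8)[OF eg]])
      from arg_cong[OF this, of star] show ?thesis
        using half_angleD(1)[OF b(1)[OF eg]] sT by (simp add: projectionD)
    qed
    then have "E * ?T = 0" unfolding E(3) by auto
    then show ?thesis using E(2) by (simp add: algebra_simps projectionD)
  qed
  moreover have "G * E * G = (1/2) *\<^sub>R G"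
  proof -
    let ?T = "G * E * G - (1/2) *\<^sub>R G"
    have sT: "star ?T = ?T" using E(2) G(2) by (simp add: projectionD mult.assoc)
    have "g * ?T = 0" if eg: "(e, g) \<in> F" for e g
    proof -
      have "?T * g = 0"
        by (simp add: algebra_simps b[OF eg] half_angleD[OF b(1)[OF eg]] mult_eq_assoc[OF b(9)[OF eg]])
      from arg_cong[OF this, of star] show ?thesis
        using half_angleD(2)[OF b(1)[OF eg]] sT by (simp add: projectionD)
    qed
    then have "G * ?T = 0" unfolding G(3) by auto
    then show ?thesis using G(2) by (simp add: algebra_simps projectionD)
  qed
  ultimately have EG: "half_angle E G" using E(2) G(2) by (simp add: half_angle_def)
  define V where "V = 2 *\<^sub>R (G * E) - E"
  define Q where "Q = star V * V + V * star V"
  note V = half_angle_partial_isometry[OF EG, folded V_def, folded Q_def]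
  have VM: "V \<in> M" using E G by (simp add: V_def closed)
  then have QM: "Q \<in> M" by (simp add: Q_def closed)
  have RQ: "R * Q = Q" using V(6) \<open>R * E = E\<close> \<open>R * G = G\<close> by blast
  note RQ' = projection_diff[OF R(2) V(5) RQ]
  have "Q = R"
  proof (rule ccontr)
    assume "Q \<noteq> R"
    then have "R - Q \<noteq> 0" by simp
    then obtain e g where eg: "e \<in> M" "g \<in> M" "half_angle e g" "e \<noteq> 0" "(R - Q) * e = e" "(R - Q) * g = g"
      using half_angle_below[of "R - Q"] R(1) QM RQ'(1) closed by metis
    have QRQ: "Q * (R - Q) = 0" using RQ'(2) V(5) by (simp add: algebra_simps projectionD)
    have RRQ: "R * (R - Q) = R - Q" using RQ R(2) by (simp add: algebra_simps projectionD)
    have Q0: "Q * e = 0" "Q * g = 0" using QRQ eg by (metis mult.assoc mult_zero_left)+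
    have R1: "R * e = e" "R * g = g" using RRQ eg by (metis mult.assoc)+
    have EQ: "E * Q = E" using arg_cong[OF V(3), of star] E(2) V(5) by (simp add: projectionD)
    have GQ: "G * Q = G" using arg_cong[OF V(4), of star] G(2) V(5) by (simp add: projectionD)
    have E0: "E * e = 0" "E * g = 0" "G * e = 0" "G * g = 0"
      using EQ GQ Q0 by (metis mult.assoc mult_zero_right)+
    have o: "orth (e', g') (e, g)" if "(e', g') \<in> F" for e' g'
    proof -
      have "e' * X = 0" if "E * X = 0" for X
        using arg_cong[OF that, of "(*) e'"] b(4)[OF \<open>(e', g') \<in> F\<close>] by (simp flip: mult.assoc)
      moreover have "g' * X = 0" if "G * X = 0" for X
        using arg_cong[OF that, of "(*) g'"] b(5)[OF \<open>(e', g') \<in> F\<close>] by (simp flip: mult.assoc)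
      ultimately show ?thesis using E0 by (simp add: orth_def)
    qed
    have o': "orth (e, g) (e', g')" if "(e', g') \<in> F" for e' g'
    proof -
      have sa: "star e' = e'" "star g' = g'" "star e = e" "star g = g"
        using half_angleD(1,2)[OF b(1)[OF that]] half_angleD(1,2)[OF eg(3)] by (simp_all add: projectionD)
      have "A * B = 0" if "B * A = 0" "star A = A" "star B = B" for A B :: "'h bop"
        using arg_cong[OF that(1), of star] that(2,3) by simp
      then show ?thesis using o[OF that] sa unfolding orth_def by simp
    qed
    have "insert (e, g) F \<in> ?A"
      using F o o' eg R1 by (auto simp: blocks_def)
    from max[rule_format, OF this] have "(e, g) \<in> F" by blast
    then have "E * e = e" by (rule b)
    then show False using E0 eg(4) by simp
  qed
  then show ?thesis using that VM V(2) V(1) E(2) by (simp add: Q_def)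
qed

end


section \<open>The singular subalgebra\<close>

lemma partial_isometry_mult:
  assumes "projection (star V * V)"
  shows "V * (star V * V) = V"
proof -
  have "star (V - V * (star V * V)) * (V - V * (star V * V)) = 0"
    using projectionD(1)[OF assms] by (simp add: algebra_simps)
  then show ?thesis using star_mult_self_eq_0 by fastforce
qed

lemma vN_relative_commutant:
  assumes M: "vN M" and P: "star P = P"
  shows "vN {A \<in> M. A * P = P * A}"
proof -
  have "{A \<in> M. A * P = P * A} = comm (comm M) \<inter> comm {P}"
    using M by (auto simp: vN_def comm_def[of "{P}"])
  also have "\<dots> = comm (comm M \<union> {P})" by (auto simp: comm_def)
  finally show ?thesis
    using P by (simp only:) (intro vN_comm, auto intro: comm_star vN_starD[OF M])
qed

text \<open>Finiteness is that of the identity: every isometry is unitary.\<close>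

locale II1_factor = continuous_factor M for M :: "('h::complex_hilbert_space) bop set" +
  assumes finite: "V \<in> M \<Longrightarrow> star V * V = 1 \<Longrightarrow> V * star V = 1"
    and nontrivial: "(1::'h bop) \<noteq> 0"
begin

text \<open>The identity is halved into \<open>E\<close> and \<open>1 - E\<close>, and \<open>E\<close> into \<open>P\<close> and \<open>E - P\<close>. The \<open>v r\<close> are partial
  isometries from \<open>P\<close> onto \<open>E - P\<close> and onto the two halves of \<open>1 - E\<close>.\<close>

lemma quarter:
  obtains P and v :: "nat \<Rightarrow> 'h bop" where "P \<in> M" "projection P" "P \<noteq> 0" "P \<noteq> 1" "\<And>r. v r \<in> M"
    "\<And>r q. r < 3 \<Longrightarrow> q < 3 \<Longrightarrow> star (v r) * v q = (if r = q then P else 0)"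
    "(\<Sum>r<3. v r * star (v r)) = 1 - P"
    "\<And>U. U \<in> M \<Longrightarrow> star U * U = P \<Longrightarrow> U * star U \<noteq> 1 - P"
proof -
  have "projection (1 :: 'h bop)" by (simp add: projection_def)
  then obtain V where V: "V \<in> M" "V * V = 0" "star V * V + V * star V = 1" "projection (star V * V)"
    using halving[of 1] closed(1) by blast
  define E where "E = star V * V"
  have E: "E \<in> M" "projection E" using V by (auto simp: E_def closed)
  obtain W where W: "W \<in> M" "W * W = 0" "star W * W + W * star W = E" "projection (star W * W)"
    using halving[OF E] by blast
  define P where "P = star W * W"
  have P: "P \<in> M" "projection P" using W by (auto simp: P_def closed)
  have WP: "W * P = W" unfolding P_def by (rule partial_isometry_mult[OF W(4)])
  have VE: "V * E = V" unfolding E_def by (rule partial_isometry_mult[OF V(4)])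
  have sWW: "star W * star W = 0" using arg_cong[OF W(2), of star] by simp
  have sVV: "star V * star V = 0" using arg_cong[OF V(2), of star] by simp
  have PW: "P * W = 0" by (simp add: P_def mult.assoc W(2))
  have EW: "E * W = W" using WP by (simp add: W(3)[symmetric] distrib_right mult.assoc W(2) P_def)
  have WE: "star W * E = star W" using arg_cong[OF EW, of star] E by (simp add: projectionD)
  have "E * P = (star W * W) * P + W * (star W * star W) * W"
    by (simp add: W(3)[symmetric] P_def distrib_right mult.assoc)
  then have EP: "E * P = P" by (simp add: sWW projectionD[OF P(2)] flip: P_def)
  have PE: "P * E = P" using arg_cong[OF EP, of star] P E by (simp add: projectionD)
  have EV: "E * V = 0" by (simp add: E_def mult.assoc V(2))
  have WV: "star W * V = 0" by (metis EV WE mult.assoc mult_zero_right)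
  have PV: "P * V = 0" by (metis EV PE mult.assoc mult_zero_right)
  have WV': "star V * W = 0" using arg_cong[OF WV, of star] by simp
  have VP': "star V * P = 0" using arg_cong[OF PV, of star] P by (simp add: projectionD)
  have WP': "star W * P = 0" using arg_cong[OF PW, of star] P by (simp add: projectionD)
  have "E \<noteq> 1"
  proof
    assume "E = 1"
    then have "star V = 0 \<and> V = 0" using EV by simp
    then show False using \<open>E = 1\<close> nontrivial by (simp add: E_def)
  qed
  have P0: "P \<noteq> 0"
  proof
    assume "P = 0"
    then have "W = 0" using WP by simp
    then have "E = 0" using W(3) by simp
    then have "V = 0" using VE by simp
    then show False using V(3) nontrivial by simp
  qed
  have P1: "P \<noteq> 1" using PE \<open>E \<noteq> 1\<close> by auto
  define v :: "nat \<Rightarrow> 'h bop" where "v r = (if r = 0 then W else if r = 1 then V * P else V * W)" for r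
  have "v r \<in> M" for r using W V P by (simp add: v_def closed)
  moreover have "star (v r) * v q = (if r = q then P else 0)" if "r < 3" "q < 3" for r q
  proof -
    have VV: "star V * (V * X) = E * X" for X by (simp add: E_def mult.assoc)
    have *: "r = 0 \<or> r = 1 \<or> r = 2" "q = 0 \<or> q = 1 \<or> q = 2" using that by auto
    have sWE: "star W * W = P" by (simp add: P_def)
    show ?thesis
      using *(1) *(2)
      by (elim disjE) (simp_all add: v_def mult.assoc VV EP EW WE PW WV WP' WV' projectionD[OF P(2)]
          sWE mult_eq_assoc[OF WV] mult_eq_assoc[OF WV'])
  qed
  moreover have "(\<Sum>r<3. v r * star (v r)) = 1 - P"
  proof -
    have "(\<Sum>r<3. v r * star (v r)) = W * star W + V * (P * P) * star V + V * (W * star W) * star V"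
      by (simp add: v_def numeral_3_eq_3 projectionD(2)[OF P(2)] mult.assoc)
    also have "\<dots> = W * star W + V * (P + W * star W) * star V"
      by (simp add: projectionD(1)[OF P(2)] algebra_simps)
    also have "P + W * star W = E" using W(3) by (simp add: P_def)
    also have "W * star W + V * E * star V = 1 - P"
    proof -
      have "P + W * star W + V * star V = 1" using V(3) W(3) by (simp add: P_def E_def)
      then show ?thesis by (simp add: VE algebra_simps)
    qed
    finally show ?thesis .
  qed
  moreover have "U * star U \<noteq> 1 - P" if U: "U \<in> M" "star U * U = P" for U
  proof
    assume UU: "U * star U = 1 - P"
    \<comment> \<open>\<open>P + W U\<^sup>*\<close> would be an isometry of \<open>M\<close> onto \<open>E \<noteq> 1\<close>.\<close>
    have UP: "U * P = U" using partial_isometry_mult[of U] U P by simp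
    then have "(1 - P) * U = U" using UU U(2) by (metis mult.assoc)
    then have PU: "P * U = 0" by (simp add: algebra_simps)
    have PU': "star U * P = 0"
      using arg_cong[OF PU, of star] by (simp add: projectionD[OF P(2)])
    define T where "T = P + W * star U"
    have sT: "star T = P + U * star W" by (simp add: T_def projectionD[OF P(2)])
    have "star T * T = P + U * (star W * W) * star U"
      unfolding sT by (simp add: T_def distrib_left distrib_right projectionD[OF P(2)]
          mult.assoc mult_eq_assoc[OF PW] mult_eq_assoc[OF WP'] WP')
    also have "\<dots> = 1" by (simp add: P_def[symmetric] UP UU)
    finally have "T * star T = 1"
      using W U P by (intro finite) (auto simp: T_def closed)
    moreover have "T * star T = P + W * (star U * U) * star W"
      unfolding sT by (simp add: T_def distrib_left distrib_right projectionD[OF P(2)]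
          mult.assoc mult_eq_assoc[OF PU] mult_eq_assoc[OF PU'] PU')
    ultimately have "P + W * star W = 1" by (simp add: U(2) WP)
    then have "E = 1" using W(3) by (simp add: P_def)
    then show False using \<open>E \<noteq> 1\<close> by simp
  qed
  ultimately show ?thesis using that P P0 P1 by blast
qed

text \<open>An idempotent of \<open>M\<close> that commutes with the relative commutant of \<open>P\<close> restricts to \<open>0\<close> or to
  the identity on the range of \<open>P\<close>, because \<open>P R\<close> and \<open>P (1 - R)\<close> are orthogonal and \<open>P R\<close> commutes
  with \<open>P M P\<close>.\<close>

lemma corner_central_projection:
  assumes P: "P \<in> M" "projection P" and R: "R \<in> M" "R * R = R"
    and comm: "\<And>A. A \<in> M \<Longrightarrow> A * P = P * A \<Longrightarrow> A * R = R * A"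
  shows "P * R = 0 \<or> P * R = P"
proof -
  have PR: "P * R = R * P" using comm P(1) by blast
  have "P * R * A * (P * (1 - R)) = 0" if A: "A \<in> M" for A
  proof -
    have "P * A * P * R = R * (P * A * P)"
      using A P by (intro comm) (simp_all add: closed projectionD mult.assoc)
    have "P * R * A * (P * (1 - R)) = R * (P * A * P) * (1 - R)" by (simp add: PR mult.assoc)
    also have "\<dots> = P * A * P * (R * (1 - R))"
      unfolding \<open>P * A * P * R = R * (P * A * P)\<close>[symmetric] by (simp add: mult.assoc)
    finally show ?thesis using R(2) by (simp add: right_diff_distrib)
  qed
  then have "P * R = 0 \<or> P * (1 - R) = 0"
    using P R by (intro factor_prod_eq_0[OF vN center]) (auto simp: closed)
  then show ?thesis by (auto simp: right_diff_distrib)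
qed

lemma normalizer_relative_commutant:
  assumes P: "P \<in> M" "projection P" "P \<noteq> 0" "P \<noteq> 1"
    and inequiv: "\<And>U. U \<in> M \<Longrightarrow> star U * U = P \<Longrightarrow> U * star U \<noteq> 1 - P"
    and U: "U \<in> M" "star U * U = 1" "U * star U = 1"
    and norm: "(\<lambda>A. U * A * star U) ` {A \<in> M. A * P = P * A} = {A \<in> M. A * P = P * A}" (is "_ ` ?N = ?N")
  shows "U \<in> ?N"
proof -
  define R where "R = U * P * star U"
  have P': "1 - P \<in> M" "projection (1 - P)"
    using P projection_diff(1)[of 1 P] by (auto simp: closed projection_def)
  have RM: "R \<in> M" using P U by (simp add: R_def closed)
  have RR: "R * R = R"
    by (simp add: R_def mult.assoc mult_eq_assoc[OF U(2)] projectionD[OF P(2)])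
  have comm: "A * R = R * A" if "A \<in> M" "A * P = P * A" for A
  proof -
    have "A \<in> (\<lambda>A. U * A * star U) ` ?N" using that norm by blast
    then obtain B where B: "A = U * B * star U" "B * P = P * B" by blast
    then show ?thesis
      by (simp add: R_def mult.assoc mult_eq_assoc[OF U(2)] mult_eq_assoc[OF B(2)])
  qed
  have 1: "P * R = 0 \<or> P * R = P"
    by (rule corner_central_projection[OF P(1,2) RM RR]) (fact comm)
  have 2: "(1 - P) * R = 0 \<or> (1 - P) * R = 1 - P"
    by (rule corner_central_projection[OF P' RM RR]) (auto intro: comm simp: algebra_simps)
  have UR: "star U * R * U = P"
    by (simp add: R_def mult.assoc mult_eq_assoc[OF U(2)] U(2))
  have R: "R = P * R + (1 - P) * R" by (simp add: algebra_simps)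
  have "R \<noteq> 0" using UR P(3) by auto
  moreover have "R \<noteq> 1" using UR P(4) U(2) by auto
  moreover have "R \<noteq> 1 - P"
  proof -
    have "U * P * star (U * P) \<noteq> 1 - P"
      using P U by (intro inequiv) (auto simp: closed projectionD mult.assoc mult_eq_assoc[OF U(2)])
    then show ?thesis by (simp add: R_def projectionD[OF P(2)] mult.assoc)
  qed
  ultimately have "R = P" using R 1 2 by auto
  then have "R * U = P * U" by simp
  then have "U * P = P * U" by (simp add: R_def mult.assoc U(2))
  then show ?thesis using U by simp
qed

lemma relative_commutant_neq:
  assumes P: "P \<in> M" "projection P" "P \<noteq> 0" "P \<noteq> 1"
  shows "{A \<in> M. A * P = P * A} \<noteq> M"
proof
  assume "{A \<in> M. A * P = P * A} = M"
  then have "A * P = P * A" if "A \<in> M" for A using that by blast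
  then have "P * A * (1 - P) = 0" if "A \<in> M" for A
    using that projectionD[OF P(2)] by (simp add: algebra_simps) 
  then have "P = 0 \<or> 1 - P = 0" using P by (intro factor_prod_eq_0[OF vN center]) auto
  then show False using P by simp
qed

end


section \<open>Operators on square-summable sequences\<close>

lemma norm_ell2_single: "norm (ell2_single k x) = norm x"
proof -
  have "(norm (ell2_single k x))\<^sup>2 = (\<Sum>n. if n = k then (norm x)\<^sup>2 else 0)"
    unfolding norm_ell2_square by (intro suminf_cong) (simp add: ell2_single.rep_eq)
  also have "\<dots> = (norm x)\<^sup>2" by (subst suminf_finite[of "{k}"]) auto
  finally show ?thesis by simp
qed

lemma cinner_ell2_single: "cinner (ell2_single k x) f = cinner x (ell2_nth f k)"
proof -
  have "cinner (ell2_single k x) f = (\<Sum>n. if n = k then cinner x (ell2_nth f k) else 0)"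
    unfolding cinner_ell2_def by (intro suminf_cong) (simp add: ell2_single.rep_eq)
  also have "\<dots> = cinner x (ell2_nth f k)" by (subst suminf_finite[of "{k}"]) auto
  finally show ?thesis .
qed

lemma bop_ell2_eqI:
  assumes "\<And>k x. oper A (ell2_single k x) = oper B (ell2_single k x)"
  shows "A = B"
proof (rule bop_eqI)
  fix f
  have "(\<lambda>k. oper T (ell2_single k (ell2_nth f k))) sums oper T f" for T :: "'a ell2 bop"
    by (intro bounded_linear.sums[OF oper_bounded_linear] ell2_single_sums)
  from this[of A] this[of B] show "oper A f = oper B f"
    unfolding assms by (rule sums_unique2)
qed

text \<open>The operator on square-summable sequences with the given coordinate functions. It is only
  meaningful if they define a bounded linear operator, as in the lemma below.\<close>

definition coordinatewise ::
    "('h::complex_hilbert_space ell2 \<Rightarrow> nat \<Rightarrow> 'h) \<Rightarrow> 'h ell2 bop" where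
  "coordinatewise T = (SOME A. \<forall>f n. ell2_nth (oper A f) n = T f n)"

lemma coordinatewise:
  fixes T :: "'h::complex_hilbert_space ell2 \<Rightarrow> nat \<Rightarrow> 'h"
  assumes add: "\<And>f g n. T (f + g) n = T f n + T g n"
    and scale: "\<And>c f n. T (c *\<^sub>C f) n = c *\<^sub>C T f n"
    and bound: "\<And>f N. (\<Sum>n<N. (norm (T f n))\<^sup>2) \<le> C\<^sup>2 * (norm f)\<^sup>2" and C: "C \<ge> 0"
  shows "ell2_nth (oper (coordinatewise T) f) n = T f n"
proof -
  define A where "A f = Abs_ell2 (T f)" for f
  have summ: "summable (\<lambda>n. (norm (T f n))\<^sup>2)" for f
    by (rule bounded_imp_summable[where B = "C\<^sup>2 * (norm f)\<^sup>2"])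
      (use bound[of f "Suc _"] in \<open>auto simp: lessThan_Suc_atMost\<close>)
  then have nth: "ell2_nth (A f) n = T f n" for f n
    by (simp add: A_def Abs_ell2_inverse)
  have "A (f + g) = A f + A g" "A (c *\<^sub>C f) = c *\<^sub>C A f" for f g c
    by (auto intro!: ell2_eqI simp: nth ell2_nth_simps add scale)
  moreover have "norm (A f) \<le> norm f * C" for f
  proof -
    have "(norm (A f))\<^sup>2 \<le> C\<^sup>2 * (norm f)\<^sup>2"
      unfolding norm_ell2_square[of "A f"] nth by (intro suminf_le_const summ bound)
    also have "\<dots> = (norm f * C)\<^sup>2" by (simp add: power_mult_distrib)
    finally show ?thesis by (rule power2_le_imp_le) (use C in simp)
  qed
  ultimately have "A \<in> bounded_ops"
    by (auto simp: bounded_ops_def scaleR_eq_scaleC intro!: bounded_linear_intro[where K = C])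
  then obtain A' where "A = oper A'" by (metis Abs_bop_inverse)
  then have "\<exists>A'. \<forall>f n. ell2_nth (oper A' f) n = T f n" using nth by metis
  from someI_ex[OF this] show ?thesis unfolding coordinatewise_def by blast
qed

text \<open>The amplification \<open>A \<otimes> 1\<close>.\<close>

definition diag :: "('h::complex_hilbert_space) bop \<Rightarrow> 'h ell2 bop" where
  "diag A = coordinatewise (\<lambda>f n. oper A (ell2_nth f n))"

lemma diag_nth: "ell2_nth (oper (diag A) f) n = oper A (ell2_nth f n)"
proof -
  obtain C where C: "C > 0" "\<And>x. norm (oper A x) \<le> C * norm x" using bop_bound[of A] by blast
  have "(\<Sum>n<N. (norm (oper A (ell2_nth f n)))\<^sup>2) \<le> C\<^sup>2 * (norm f)\<^sup>2" for f N
  proof -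
    have "(\<Sum>n<N. (norm (oper A (ell2_nth f n)))\<^sup>2) \<le> (\<Sum>n<N. C\<^sup>2 * (norm (ell2_nth f n))\<^sup>2)"
      unfolding power_mult_distrib[symmetric] by (intro sum_mono power_mono C(2)) auto
    also have "\<dots> \<le> C\<^sup>2 * (norm f)\<^sup>2"
      unfolding sum_distrib_left[symmetric] by (intro mult_left_mono sum_norm_ell2_le) auto
    finally show ?thesis .
  qed
  then show ?thesis
    unfolding diag_def using C(1)
    by (intro coordinatewise[where C = C]) (auto simp: ell2_nth_simps oper_add oper_scaleC)
qed

lemma diag_single: "oper (diag A) (ell2_single k x) = ell2_single k (oper A x)"
  by (rule ell2_eqI) (simp add: diag_nth ell2_single.rep_eq oper_zero)

lemma diag_mult: "diag (A * B) = diag A * diag B"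
  and diag_add: "diag (A + B) = diag A + diag B"
  and diag_diff: "diag (A - B) = diag A - diag B"
  and diag_one: "diag 1 = 1"
  and diag_zero: "diag 0 = 0"
  by (rule bop_eqI, rule ell2_eqI, simp add: diag_nth oper_simps ell2_nth_simps)+

lemma diag_sum: "diag (\<Sum>i\<in>I. f i) = (\<Sum>i\<in>I. diag (f i))"
  by (induction I rule: infinite_finite_induct) (simp_all add: diag_zero diag_add)

lemma star_diag: "star (diag A) = diag (star A)"
  by (rule star_eqI) (simp add: inner_eq_Re_cinner cinner_ell2_def diag_nth cinner_oper)

text \<open>The matrix unit \<open>1 \<otimes> e\<^sub>i\<^sub>j\<close>.\<close>

definition matrix_unit :: "nat \<Rightarrow> nat \<Rightarrow> ('h::complex_hilbert_space) ell2 bop" where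
  "matrix_unit i j = coordinatewise (\<lambda>f n. if n = i then ell2_nth f j else 0)"

lemma matrix_unit_nth:
  "ell2_nth (oper (matrix_unit i j) f) n = (if n = i then ell2_nth f j else 0)"
proof -
  have "(\<Sum>n<N. (norm (if n = i then ell2_nth f j else 0))\<^sup>2) \<le> 1\<^sup>2 * (norm f)\<^sup>2"
    for f :: "'a ell2" and N
  proof -
    have "(\<Sum>n<N. (norm (if n = i then ell2_nth f j else 0))\<^sup>2)
        = (\<Sum>n<N. if n = i then (norm (ell2_nth f j))\<^sup>2 else 0)"
      by (intro sum.cong) auto
    also have "\<dots> \<le> (norm (ell2_nth f j))\<^sup>2" by (simp add: sum.delta')
    also have "\<dots> \<le> 1\<^sup>2 * (norm f)\<^sup>2" using norm_ell2_nth_le[of f j] by (simp add: power_mono)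
    finally show ?thesis .
  qed
  then show ?thesis
    unfolding matrix_unit_def
    by (intro coordinatewise[where C = 1]) (auto simp: ell2_nth_simps scaleC_zero_right)
qed

text \<open>The entry in row \<open>i\<close> and column \<open>j\<close> of the operator matrix of \<open>T\<close>.\<close>

lift_definition entry :: "('h::complex_hilbert_space) ell2 bop \<Rightarrow> nat \<Rightarrow> nat \<Rightarrow> 'h bop" is
  "\<lambda>T i j x. ell2_nth (T (ell2_single j x)) i"
proof -
  fix T :: "'h ell2 \<Rightarrow> 'h ell2" and i j assume "T \<in> bounded_ops"
  then obtain T' where T: "T = oper T'" by (metis Abs_bop_inverse)
  obtain C where C: "C > 0" "\<And>x. norm (oper T' x) \<le> C * norm x" using bop_bound[of T'] by blast
  have "ell2_single j (x + y) = ell2_single j x + ell2_single j y"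
    "ell2_single j (c *\<^sub>C x) = c *\<^sub>C ell2_single j x" for x y :: 'h and c
    by (auto intro!: ell2_eqI simp: ell2_nth_simps ell2_single.rep_eq scaleC_zero_right)
  moreover have "norm (ell2_nth (oper T' (ell2_single j x)) i) \<le> norm x * C" for x
    using norm_ell2_nth_le[of "oper T' (ell2_single j x)" i] C(2)[of "ell2_single j x"]
    by (simp add: norm_ell2_single mult.commute)
  ultimately show "(\<lambda>x. ell2_nth (T (ell2_single j x)) i) \<in> bounded_ops"
    unfolding bounded_ops_def T
    by (auto simp: oper_add oper_scaleC ell2_nth_simps scaleR_eq_scaleC
        intro!: bounded_linear_intro[where K = C])
qed

lemma commute_diag_iff:
  "T * diag X = diag X * T \<longleftrightarrow> (\<forall>i j. entry T i j * X = X * entry T i j)"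
proof
  assume T: "T * diag X = diag X * T"
  have "oper (entry T i j * X) x = oper (X * entry T i j) x" for i j x
  proof -
    have "oper (T * diag X) (ell2_single j x) = oper (diag X * T) (ell2_single j x)" using T by simp
    then have "ell2_nth (oper T (ell2_single j (oper X x))) i = oper X (ell2_nth (oper T (ell2_single j x)) i)"
      by (metis diag_nth diag_single times_bop.rep_eq)
    then show ?thesis by (simp add: times_bop.rep_eq entry.rep_eq)
  qed
  then show "\<forall>i j. entry T i j * X = X * entry T i j" using bop_eqI by blast
next
  assume T: "\<forall>i j. entry T i j * X = X * entry T i j"
  have "ell2_nth (oper T (ell2_single j (oper X x))) i = oper X (ell2_nth (oper T (ell2_single j x)) i)" for i j x
    using T by (metis times_bop.rep_eq entry.rep_eq)
  then show "T * diag X = diag X * T"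
    by (intro bop_ell2_eqI ell2_eqI) (simp add: times_bop.rep_eq diag_single diag_nth)
qed

lemma ell2_tensor_single: "ell2_single k x = ell2_tensor x (ell2_single k 1)"
  by (auto intro!: ell2_eqI simp: ell2_single.rep_eq ell2_tensor.rep_eq scaleC_one)

section \<open>Tensoring with the bounded operators on sequences\<close>

text \<open>The commutant of \<open>N \<otimes> B(l\<^sup>2)\<close> consists of the amplifications of the
  commutant of \<open>N\<close>: commuting with the matrix units forces an operator to be diagonal
  with constant entry.\<close>

lemma vn_tensor_bounded_ops:
  fixes N :: "('h::complex_hilbert_space) bop set"
  assumes 1: "1 \<in> N"
  shows "vn_tensor ell2_tensor (oper ` N) (bounded_ops :: (complex ell2 \<Rightarrow> complex ell2) set)
    = oper ` comm (diag ` comm N)"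
proof -
  let ?P = "\<lambda>T. \<exists>A\<in>N. \<exists>B\<in>(bounded_ops :: (complex ell2 \<Rightarrow> complex ell2) set).
    \<forall>x y. oper T (ell2_tensor x y) = ell2_tensor (oper A x) (B y)"
  define S where "S = {T :: 'h ell2 bop. ?P T}"
  have "{T \<in> bounded_ops. \<exists>A\<in>oper ` N. \<exists>B\<in>(bounded_ops :: (complex ell2 \<Rightarrow> complex ell2) set).
      \<forall>x y. T (ell2_tensor x y) = ell2_tensor (A x) (B y)} = oper ` S"
  proof (intro set_eqI iffI)
    fix T assume T: "T \<in> {T \<in> bounded_ops. \<exists>A\<in>oper ` N. \<exists>B\<in>(bounded_ops :: (complex ell2 \<Rightarrow> complex ell2) set).
      \<forall>x y. T (ell2_tensor x y) = ell2_tensor (A x) (B y)}"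
    then obtain T' where "T = oper T'" by (metis (no_types, lifting) Abs_bop_inverse mem_Collect_eq)
    then show "T \<in> oper ` S" using T unfolding S_def by blast
  next
    fix T assume "T \<in> oper ` S"
    then obtain T' where "T = oper T'" "T' \<in> S" by blast
    then show "T \<in> {T \<in> bounded_ops. \<exists>A\<in>oper ` N. \<exists>B\<in>(bounded_ops :: (complex ell2 \<Rightarrow> complex ell2) set).
      \<forall>x y. T (ell2_tensor x y) = ell2_tensor (A x) (B y)}"
      unfolding S_def using oper[of T'] by blast
  qed
  then have *: "vn_tensor ell2_tensor (oper ` N) (bounded_ops :: (complex ell2 \<Rightarrow> complex ell2) set)
      = oper ` comm (comm S)"
    unfolding vn_tensor_def by (simp add: commutant_oper)
  have unit: "matrix_unit i j \<in> S" for i j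
  proof -
    have "oper (matrix_unit i j) (ell2_tensor x y) = ell2_tensor (oper 1 x) (oper (matrix_unit i j) y)"
      for x :: 'h and y
      by (rule ell2_eqI) (simp add: matrix_unit_nth ell2_tensor.rep_eq oper_simps)
    then show ?thesis unfolding S_def using 1 oper by blast
  qed
  have diagS: "diag A \<in> S" if "A \<in> N" for A
  proof -
    have "oper (diag A) (ell2_tensor x y) = ell2_tensor (oper A x) (oper 1 y)" for x y
      by (rule ell2_eqI) (simp add: diag_nth ell2_tensor.rep_eq oper_simps oper_scaleC)
    then show ?thesis unfolding S_def using that oper by blast
  qed
  have "comm S = diag ` comm N"
  proof (intro equalityI subsetI)
    fix X assume X: "X \<in> comm S"
    have Xu: "oper X (oper (matrix_unit i j) f) = oper (matrix_unit i j) (oper X f)" for i j f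
      using X unit[of i j] unfolding comm_def by (metis (mono_tags, lifting) mem_Collect_eq times_bop.rep_eq)
    have us: "oper (matrix_unit k j) (ell2_single j x) = ell2_single k x" for k j and x :: 'h
      by (rule ell2_eqI) (simp add: matrix_unit_nth ell2_single.rep_eq)
    have Xd: "X = diag (entry X 0 0)"
    proof (rule bop_ell2_eqI, rule ell2_eqI)
      fix k n and x :: 'h
      have "oper X (ell2_single k x) = oper (matrix_unit k 0) (oper X (ell2_single 0 x))"
        by (simp flip: Xu add: us)
      then show "ell2_nth (oper X (ell2_single k x)) n
          = ell2_nth (oper (diag (entry X 0 0)) (ell2_single k x)) n"
        by (simp add: diag_single matrix_unit_nth ell2_single.rep_eq entry.rep_eq)
    qed
    have "entry X 0 0 * A = A * entry X 0 0" if "A \<in> N" for A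
    proof -
      have "X * diag A = diag A * X" using X diagS[OF that] by (simp add: comm_def)
      then show ?thesis unfolding commute_diag_iff by blast
    qed
    then have "entry X 0 0 \<in> comm N" by (simp add: comm_def)
    then show "X \<in> diag ` comm N" using Xd by blast
  next
    fix X assume "X \<in> diag ` comm N"
    then obtain Y where Y: "X = diag Y" "Y \<in> comm N" by blast
    have dt: "oper (diag Y) (ell2_tensor u w) = ell2_tensor (oper Y u) w" for u w
      by (rule ell2_eqI) (simp add: diag_nth ell2_tensor.rep_eq oper_scaleC)
    have "diag Y * T = T * diag Y" if "T \<in> S" for T
    proof -
      obtain A B where A: "A \<in> N" and T: "\<And>x y. oper T (ell2_tensor x y) = ell2_tensor (oper A x) (B y)"
        using \<open>T \<in> S\<close> unfolding S_def by blast
      have "oper Y (oper A x) = oper A (oper Y x)" for x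
        using Y(2) A unfolding comm_def by (metis (mono_tags, lifting) mem_Collect_eq times_bop.rep_eq)
      then show ?thesis
        by (intro bop_ell2_eqI) (simp add: ell2_tensor_single[where x = "_ :: 'h"] times_bop.rep_eq T dt)
    qed
    then show "X \<in> comm S" by (simp add: comm_def Y(1))
  qed
  then show ?thesis by (simp add: *)
qed

text \<open>For a von Neumann algebra \<open>N\<close>, the algebra \<open>N \<otimes> B(l\<^sup>2)\<close> in the form found in \<open>vn_tensor_bounded_ops\<close>. By \<open>commute_diag_iff\<close>
  it consists of the operators whose entries commute with the commutant of \<open>N\<close>.\<close>

definition amplification :: "('h::complex_hilbert_space) bop set \<Rightarrow> 'h ell2 bop set" where
  "amplification N = comm (diag ` comm N)"

lemma vN_amplification: "vN N \<Longrightarrow> vN (amplification N)"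
  unfolding amplification_def
  by (rule vN_comm) (auto simp: star_diag intro!: imageI comm_star[of N] vN_starD[of N])

lemma amplification_mono: "N \<subseteq> M \<Longrightarrow> amplification N \<subseteq> amplification M"
  unfolding amplification_def by (intro comm_antimono image_mono)

lemma diag_mem_amplification: "A \<in> N \<Longrightarrow> diag A \<in> amplification N"
  by (auto simp: amplification_def comm_def simp flip: diag_mult)

lemma amplification_relative_commutant:
  assumes M: "vN M" and P: "P \<in> M"
  shows "amplification {A \<in> M. A * P = P * A} = {T \<in> amplification M. T * diag P = diag P * T}"
    (is "amplification ?N = _")
proof (intro equalityI subsetI)
  fix T assume T: "T \<in> amplification ?N"
  have "T \<in> amplification M" using T amplification_mono[of ?N M] by blast
  moreover have "P \<in> comm ?N" by (simp add: comm_def)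
  then have "T * diag P = diag P * T" using T by (simp add: amplification_def comm_def)
  ultimately show "T \<in> {T \<in> amplification M. T * diag P = diag P * T}" by simp
next
  fix T assume T: "T \<in> {T \<in> amplification M. T * diag P = diag P * T}"
  have "entry T i j * X = X * entry T i j" if "X \<in> comm M" for X i j
  proof -
    have "T * diag X = diag X * T" using T that by (simp add: amplification_def comm_def)
    then show ?thesis unfolding commute_diag_iff by blast
  qed
  then have "entry T i j \<in> M" for i j by (intro vN_memI[OF M]) auto
  moreover have "entry T i j * P = P * entry T i j" for i j
    using T commute_diag_iff by blast
  ultimately have "entry T i j * X = X * entry T i j" if "X \<in> comm ?N" for X i j
    using that by (simp add: comm_def)
  then have "T * diag X = diag X * T" if "X \<in> comm ?N" for X
    unfolding commute_diag_iff using that by blast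
  then show "T \<in> amplification ?N" by (simp add: amplification_def comm_def)
qed

text \<open>\<open>reindex \<phi>\<close> is the co-isometry \<open>f \<mapsto> f \<circ> \<phi>\<close> for an injective \<open>\<phi>\<close>.\<close>

definition reindex :: "(nat \<Rightarrow> nat) \<Rightarrow> ('h::complex_hilbert_space) ell2 bop" where
  "reindex \<phi> = coordinatewise (\<lambda>f n. ell2_nth f (\<phi> n))"

lemma reindex_nth:
  fixes f :: "('h::complex_hilbert_space) ell2"
  assumes \<phi>: "inj \<phi>"
  shows "ell2_nth (oper (reindex \<phi>) f) n = ell2_nth f (\<phi> n)"
proof -
  have "(\<Sum>n<N. (norm (ell2_nth f (\<phi> n)))\<^sup>2) \<le> 1\<^sup>2 * (norm f)\<^sup>2" for f :: "'h ell2" and N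
  proof -
    have "inj_on \<phi> {..<N}" using \<phi> by (rule inj_on_subset) simp
    then have "(\<Sum>n<N. (norm (ell2_nth f (\<phi> n)))\<^sup>2) = (\<Sum>m\<in>\<phi> ` {..<N}. (norm (ell2_nth f m))\<^sup>2)"
      by (simp add: sum.reindex)
    also have "\<dots> \<le> (norm f)\<^sup>2" by (rule sum_norm_ell2_le) simp
    finally show ?thesis by simp
  qed
  then show ?thesis
    unfolding reindex_def by (intro coordinatewise[where C = 1]) (auto simp: ell2_nth_simps)
qed

lemma reindex_diag: "inj \<phi> \<Longrightarrow> reindex \<phi> * diag A = diag A * reindex \<phi>"
  by (intro bop_eqI ell2_eqI) (simp add: times_bop.rep_eq reindex_nth diag_nth)

lemma star_reindex_single:
  assumes "inj \<phi>"
  shows "oper (star (reindex \<phi>)) (ell2_single k x) = ell2_single (\<phi> k) x"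
proof (rule inner_eqI)
  fix f
  have "inner f (oper (star (reindex \<phi>)) (ell2_single k x)) = inner (ell2_single k x) (oper (reindex \<phi>) f)"
    by (simp flip: inner_oper add: inner_commute)
  also have "\<dots> = inner (ell2_single (\<phi> k) x) f"
    by (simp add: inner_eq_Re_cinner cinner_ell2_single reindex_nth[OF assms])
  finally show "inner f (oper (star (reindex \<phi>)) (ell2_single k x)) = inner f (ell2_single (\<phi> k) x)"
    by (simp add: inner_commute)
qed

text \<open>If \<open>1 - P\<close> is the sum of three copies of \<open>P\<close>, then \<open>P\<close> and \<open>1 - P\<close> become equivalent
  after tensoring with \<open>B(l\<^sup>2)\<close>, since three copies of \<open>l\<^sup>2\<close> are one copy.\<close>

lemma amplified_equivalence:
  fixes M :: "('h::complex_hilbert_space) bop set"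
  assumes M: "vN M" and v: "\<And>r. v r \<in> M" and P: "star P = P"
    and vv: "\<And>r q. r < 3 \<Longrightarrow> q < 3 \<Longrightarrow> star (v r) * v q = (if r = q then P else 0)"
    and sum: "(\<Sum>r<(3::nat). v r * star (v r)) = 1 - P"
  obtains V where "V \<in> amplification M" "star V * V = diag P" "V * star V = 1 - diag P"
proof -
  define s :: "nat \<Rightarrow> 'h ell2 bop" where "s r = reindex (\<lambda>n. 3 * n + r)" for r
  have inj: "inj (\<lambda>n. 3 * n + r)" for r :: nat by (simp add: inj_def)
  have sd: "s r * diag A = diag A * s r" for r A unfolding s_def by (rule reindex_diag[OF inj])
  have sd': "star (s r) * diag A = diag A * star (s r)" for r A
    using arg_cong[OF sd[of r "star A"], of star] by (simp add: star_diag)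
  have ss: "s r * star (s q) = (if r = q then 1 else 0)" if "r < 3" "q < 3" for r q
  proof (rule bop_ell2_eqI, rule ell2_eqI)
    fix k n and x :: 'h
    have "3 * n + r = 3 * k + q \<longleftrightarrow> n = k \<and> r = q" using that by presburger
    then show "ell2_nth (oper (s r * star (s q)) (ell2_single k x)) n
        = ell2_nth (oper (if r = q then 1 else 0) (ell2_single k x)) n"
      by (auto simp: s_def times_bop.rep_eq star_reindex_single[OF inj] reindex_nth[OF inj]
          ell2_single.rep_eq oper_simps ell2_nth_simps)
  qed
  have ss1: "(\<Sum>r<3. star (s r) * s r) = 1"
  proof (rule bop_ell2_eqI)
    fix m and x :: 'h
    have "oper (star (s r) * s r) (ell2_single m x) = (if r = m mod 3 then ell2_single m x else 0)"
      if "r < 3" for r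
    proof -
      have "3 * n + r = m \<longleftrightarrow> r = m mod 3 \<and> n = m div 3" for n using that by auto
      then have "oper (s r) (ell2_single m x) = (if r = m mod 3 then ell2_single (m div 3) x else 0)"
        by (intro ell2_eqI) (auto simp: s_def reindex_nth[OF inj] ell2_single.rep_eq ell2_nth_simps)
      then show ?thesis
        by (simp add: times_bop.rep_eq oper_zero) (simp add: s_def star_reindex_single[OF inj])
    qed
    moreover have "oper (\<Sum>r<3. star (s r) * s r) (ell2_single m x)
        = (\<Sum>r<3. oper (star (s r) * s r) (ell2_single m x))"
      by (simp add: numeral_3_eq_3 oper_simps)
    ultimately show "oper (\<Sum>r<3. star (s r) * s r) (ell2_single m x) = oper 1 (ell2_single m x)"
      by (simp add: oper_simps)
  qed
  define V where "V = (\<Sum>r<3. diag (v r) * s r)"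
  have sV: "star V = (\<Sum>r<3. star (s r) * diag (star (v r)))"
    by (simp add: V_def numeral_3_eq_3 star_diag)
  have "V * star V = (\<Sum>r<3. \<Sum>q<3. diag (v r) * (s r * star (s q)) * diag (star (v q)))"
    by (subst sV, subst V_def) (simp only: sum_product mult.assoc)
  also have "\<dots> = (\<Sum>r<3. \<Sum>q<3. if r = q then diag (v r * star (v r)) else 0)"
    by (intro sum.cong) (auto simp: ss diag_mult)
  also have "\<dots> = diag (\<Sum>r<3. v r * star (v r))" by (simp add: diag_sum)
  finally have VV: "V * star V = 1 - diag P" by (simp add: sum diag_diff diag_one)
  have "star V * V = (\<Sum>r<3. \<Sum>q<3. star (s r) * diag (star (v r) * v q) * s q)"
    by (subst sV, subst V_def) (simp only: sum_product mult.assoc diag_mult)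
  also have "\<dots> = (\<Sum>r<3. \<Sum>q<3. if r = q then diag P * (star (s r) * s r) else 0)"
    by (intro sum.cong) (auto simp: vv diag_zero sd' mult.assoc)
  also have "\<dots> = diag P * (\<Sum>r<3. star (s r) * s r)" by (simp add: sum_distrib_left)
  finally have "star V * V = diag P" by (simp add: ss1)
  moreover have "V \<in> amplification M"
  proof -
    have "s r \<in> amplification M" for r by (auto simp: amplification_def comm_def sd)
    then have "diag (v r) * s r \<in> amplification M" for r
      using vN_amplification[OF M] diag_mem_amplification[OF v] by (simp add: vN_closed)
    then show ?thesis using vN_amplification[OF M] by (simp add: V_def numeral_3_eq_3 vN_closed)
  qed
  ultimately show ?thesis using VV that by blast
qed

text \<open>The symmetry \<open>W = V + V\<^sup>*\<close> exchanges \<open>p\<close> and \<open>1 - p\<close>, hence normalizes the relative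
  commutant \<open>N\<close> of \<open>p\<close>; and \<open>M = N + N W\<close>.\<close>

lemma regular_relative_commutant:
  assumes M: "vN M" and V: "V \<in> M" "star V * V = p" "V * star V = 1 - p" and p: "p \<in> M" "projection p"
  defines "N \<equiv> {A \<in> M. A * p = p * A}"
  shows "comm (comm {U \<in> M. star U * U = 1 \<and> U * star U = 1 \<and> (\<lambda>A. U * A * star U) ` N = N}) = M"
    (is "comm (comm ?G) = M")
proof -
  note pp = projectionD[OF p(2)]
  have N: "vN N" unfolding N_def using M pp(2) by (rule vN_relative_commutant)
  have Vp: "V * p = V" using partial_isometry_mult[of V] V p by simp
  have "(1 - p) * V = V" using Vp V by (metis mult.assoc)
  then have pV: "p * V = 0" by (simp add: left_diff_distrib)
  have Vp': "star V * p = 0" using arg_cong[OF pV, of star] by (simp add: pp)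
  have pV': "p * star V = star V" using arg_cong[OF Vp, of star] by (simp add: pp)
  have VV: "V * V = 0" using mult_eq_assoc[OF Vp, of V] by (simp add: pV)
  have VV': "star V * star V = 0" using arg_cong[OF VV, of star] by simp
  define W where "W = V + star V"
  have sW: "star W = W" by (simp add: W_def add.commute)
  have WW: "W * W = 1" by (simp add: W_def algebra_simps VV VV' V)
  have Wp: "W * p = (1 - p) * W" by (simp add: W_def algebra_simps Vp pV Vp' pV')
  then have pW: "p * W = W - W * p" by (simp add: algebra_simps)
  have WM: "W \<in> M" using V M by (simp add: W_def vN_closed)
  have WN: "W * A * W \<in> N" if "A \<in> N" for A
  proof -
    have Ap: "A * p = p * A" and AM: "A \<in> M" using that by (auto simp: N_def)
    have "W * A * W * p = W * (A * W - A * p * W)" by (simp add: mult.assoc Wp algebra_simps)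
    also have "\<dots> = (W - W * p) * A * W" by (simp add: Ap algebra_simps)
    also have "\<dots> = p * (W * A * W)" by (simp flip: pW add: mult.assoc)
    finally show ?thesis using AM WM M by (simp add: N_def vN_closed)
  qed
  have "W \<in> ?G"
  proof -
    have "A \<in> (\<lambda>A. W * A * W) ` N" if "A \<in> N" for A
    proof (rule image_eqI[OF _ WN[OF that]])
      show "A = W * (W * A * W) * W" by (simp add: mult.assoc mult_eq_assoc[OF WW] WW)
    qed
    then show ?thesis using WM WN by (auto simp: sW WW)
  qed
  moreover have "{U \<in> N. star U * U = 1 \<and> U * star U = 1} \<subseteq> ?G"
  proof clarify
    fix U assume U: "U \<in> N" "star U * U = 1" "U * star U = 1"
    have "A \<in> (\<lambda>A. U * A * star U) ` N" if "A \<in> N" for A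
    proof (rule image_eqI[of _ _ "star U * A * U"])
      show "A = U * (star U * A * U) * star U" by (simp add: mult.assoc mult_eq_assoc[OF U(3)] U(3))
      show "star U * A * U \<in> N" using U(1) that N by (simp add: vN_closed)
    qed
    moreover have "U * A * star U \<in> N" if "A \<in> N" for A using U(1) that N by (simp add: vN_closed)
    ultimately show "U \<in> M \<and> star U * U = 1 \<and> U * star U = 1 \<and> (\<lambda>A. U * A * star U) ` N = N"
      using U by (auto simp: N_def)
  qed
  ultimately have "W \<in> ?G" "comm ?G \<subseteq> comm N"
    unfolding comm_unitaries[OF N, symmetric] by (blast intro!: comm_antimono[THEN subsetD])+
  then have X: "X \<in> comm N \<and> X * W = W * X" if "X \<in> comm ?G" for X
    using that unfolding comm_def[of ?G] by blast
  have "comm ?G \<subseteq> comm M"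
  proof
    fix X assume "X \<in> comm ?G"
    then have XN: "X \<in> comm N" and XW: "X * W = W * X" using X by auto
    have "X * T = T * X" if T: "T \<in> M" for T
    proof -
      define D where "D = p * T * p + (1 - p) * T * (1 - p)"
      define Z where "Z = p * T * (1 - p) + (1 - p) * T * p"
      have TDZ: "T = D + Z" by (simp add: D_def Z_def algebra_simps)
      have "D * p = p * D" by (simp add: D_def algebra_simps pp)
      then have D: "D \<in> N" using T p M by (simp add: N_def D_def vN_closed)
      have Zp: "Z * p = (1 - p) * Z" "p * Z = Z * (1 - p)" by (simp_all add: Z_def algebra_simps pp)
      have "Z * W * p = Z * (1 - p) * W" by (simp add: Wp mult.assoc)
      also have "\<dots> = p * (Z * W)" by (simp flip: Zp add: mult.assoc)
      finally have ZW: "Z * W \<in> N" using T p M WM by (simp add: N_def Z_def vN_closed)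
      have Z: "Z = Z * W * W" by (simp add: mult.assoc WW)
      have XZW: "X * (Z * W) = Z * W * X" using XN ZW by (simp add: comm_def)
      have "X * (Z * W * W) = X * (Z * W) * W" by (simp add: mult.assoc)
      also have "\<dots> = Z * W * W * X" unfolding XZW by (simp only: mult.assoc XW)
      finally have "X * Z = Z * X" by (simp only: Z[symmetric])
      moreover have "X * D = D * X" using XN D by (simp add: comm_def)
      ultimately show ?thesis by (simp add: TDZ algebra_simps)
    qed
    then show "X \<in> comm M" by (simp add: comm_def)
  qed
  moreover have "comm M \<subseteq> comm ?G" by (rule comm_antimono) auto
  ultimately have "comm ?G = comm M" by blast
  then show ?thesis using M by (simp add: vN_def)
qed

section \<open>Singular and regular subalgebras\<close>

lemma unitary_op_oper: "unitary_op (oper U) \<longleftrightarrow> star U * U = 1 \<and> U * star U = 1"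
  unfolding unitary_op_def adj_oper
  by (auto simp: oper fun_eq_iff oper_inject[symmetric] oper_simps)

lemma normalizer_oper:
  "normalizer (oper ` M) (oper ` N)
    = oper ` {U \<in> M. star U * U = 1 \<and> U * star U = 1 \<and> (\<lambda>A. U * A * star U) ` N = N}"
proof -
  have "(\<lambda>A. oper U \<circ> A \<circ> adj (oper U)) ` oper ` N = oper ` (\<lambda>A. U * A * star U) ` N" for U :: "'a bop"
    unfolding image_image by (intro image_cong) (auto simp: adj_oper oper_comp)
  then have "(\<lambda>A. oper U \<circ> A \<circ> adj (oper U)) ` oper ` N = oper ` N \<longleftrightarrow> (\<lambda>A. U * A * star U) ` N = N"
    for U :: "'a bop" by (simp only: inj_image_eq_iff[OF inj_oper])
  moreover have "{T \<in> oper ` M. Q T} = oper ` {U \<in> M. Q (oper U)}" for Q :: "('a \<Rightarrow> 'a) \<Rightarrow> bool"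
    by auto
  ultimately show ?thesis
    unfolding normalizer_def by (simp only: unitary_op_oper conj_assoc)
qed

lemma type_II1_imp_II1_factor:
  assumes "factor (oper ` M)" "type_II1 (oper ` M)"
  shows "II1_factor M"
proof
  have mem: "oper A \<in> oper ` S \<longleftrightarrow> A \<in> S" for A :: "'a bop" and S
    using inj_oper by (rule inj_image_mem_iff)
  show "vN M" using assms(1) by (simp add: factor_def vn_algebra_oper)
  show "\<exists>c. A = scal c" if "A \<in> M" "A \<in> comm M" for A
  proof -
    have "oper A \<in> oper ` M \<inter> commutant (oper ` M)" using that by (simp add: commutant_oper mem)
    then obtain c where "oper A = (\<lambda>x. c *\<^sub>C x)" using assms(1) by (auto simp: factor_def)
    then show ?thesis by (metis scal.rep_eq oper_inject)
  qed
  show "P = 0" if P: "P \<in> M" "projection P"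
    and "\<And>A B. A \<in> M \<Longrightarrow> B \<in> M \<Longrightarrow> P * A * P * (P * B * P) = P * B * P * (P * A * P)" for P
  proof -
    have "abelian_projection (oper ` M) (oper P)"
      unfolding abelian_projection_def projections_def
    proof (intro conjI ballI)
      show "oper P \<in> {E \<in> oper ` M. E \<circ> E = E \<and> adj E = E}"
        using P by (auto simp: projection_def adj_oper oper_comp)
      fix A B assume "A \<in> oper ` M" "B \<in> oper ` M"
      then obtain A' B' where "A = oper A'" "B = oper B'" "A' \<in> M" "B' \<in> M" by blast
      then show "(oper P \<circ> A \<circ> oper P) \<circ> (oper P \<circ> B \<circ> oper P) = (oper P \<circ> B \<circ> oper P) \<circ> (oper P \<circ> A \<circ> oper P)"
        using that(3)[of A' B'] by (simp add: oper_comp mult.assoc)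
    qed
    then have "oper P = (\<lambda>_. 0)" using assms(2) by (simp add: type_II1_def)
    then show ?thesis by (intro bop_eqI) (simp add: oper_simps)
  qed
  show "V * star V = 1" if V: "V \<in> M" "star V * V = 1" for V
  proof -
    have "oper (V * star V) \<in> projections (oper ` M)"
    proof -
      have "V * star V * (V * star V) = V * star V" by (simp add: mult.assoc mult_eq_assoc[OF V(2)])
      moreover have "V * star V \<in> M" using V(1) \<open>vN M\<close> by (simp add: vN_closed)
      ultimately show ?thesis
        unfolding projections_def by (auto simp: adj_oper oper_comp)
    qed
    moreover have "mvn_equiv (oper ` M) id (oper (V * star V))"
      unfolding mvn_equiv_def using V
      by (intro bexI[of _ "oper V"])
        (auto simp: adj_oper oper_comp one_bop.rep_eq id_def)
    ultimately have "oper (V * star V) = id"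
      using assms(2) by (auto simp: type_II1_def finite_projection_def)
    then show ?thesis by (intro bop_eqI) (simp add: one_bop.rep_eq)
  qed
  show "(1::'a bop) \<noteq> 0"
  proof
    assume "(1::'a bop) = 0"
    then have "oper (1::'a bop) x = oper 0 x" for x by simp
    then have "(id :: 'a \<Rightarrow> 'a) = (\<lambda>_. 0)" by (simp add: fun_eq_iff oper_simps)
    then show False using assms(1) by (simp add: factor_def)
  qed
qed

theorem proposition2p13:
  fixes M :: "('h::complex_hilbert_space \<Rightarrow> 'h) set"
  assumes "factor M" and "type_II1 M"
  shows "\<exists>N. vn_subalgebra N M \<and> singular_in N M \<and> N \<noteq> M \<and>
    regular_in (vn_tensor ell2_tensor N (bounded_ops :: (complex ell2 \<Rightarrow> complex ell2) set))
               (vn_tensor ell2_tensor M (bounded_ops :: (complex ell2 \<Rightarrow> complex ell2) set))"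
proof -
  have "vn_algebra M" using assms(1) by (simp add: factor_def)
  then obtain M' where M': "M = oper ` M'" by (rule vn_algebra_obtain)
  interpret II1_factor M' using assms unfolding M' by (rule type_II1_imp_II1_factor)
  obtain P and v :: "nat \<Rightarrow> 'h bop" where P: "P \<in> M'" "projection P" "P \<noteq> 0" "P \<noteq> 1"
    and v: "\<And>r. v r \<in> M'"
    "\<And>r q. r < 3 \<Longrightarrow> q < 3 \<Longrightarrow> star (v r) * v q = (if r = q then P else 0)"
    "(\<Sum>r<3. v r * star (v r)) = 1 - P"
    and inequiv: "\<And>U. U \<in> M' \<Longrightarrow> star U * U = P \<Longrightarrow> U * star U \<noteq> 1 - P"
    using quarter by blast
  note pp = projectionD[OF P(2)]
  define N where "N = {A \<in> M'. A * P = P * A}"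
  have N: "vN N" unfolding N_def using vN pp(2) by (rule vN_relative_commutant)
  have NM: "N \<subseteq> M'" by (auto simp: N_def)
  have sub: "vn_subalgebra (oper ` N) M"
    unfolding vn_subalgebra_def M' vn_algebra_oper using N vN NM by blast
  have "singular_in (oper ` N) M"
    unfolding singular_in_def
  proof (intro conjI sub)
    show "normalizer M (oper ` N) \<subseteq> oper ` N"
      unfolding M' normalizer_oper
      using normalizer_relative_commutant[OF P inequiv] unfolding N_def by blast
  qed
  moreover have "oper ` N \<noteq> M"
    unfolding M' inj_image_eq_iff[OF inj_oper] N_def by (rule relative_commutant_neq[OF P])
  moreover have "regular_in (oper ` amplification N) (oper ` amplification M')"
    unfolding regular_in_def
  proof
    show "vn_subalgebra (oper ` amplification N) (oper ` amplification M')"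
      unfolding vn_subalgebra_def vn_algebra_oper
      using vN_amplification[OF N] vN_amplification[OF vN] amplification_mono[OF NM] by blast
    obtain V where V: "V \<in> amplification M'" "star V * V = diag P" "V * star V = 1 - diag P"
      using amplified_equivalence[OF vN v(1) pp(2) v(2,3)] by blast
    have "projection (diag P)" by (simp add: projection_def star_diag pp flip: diag_mult)
    from regular_relative_commutant[OF vN_amplification[OF vN] V diag_mem_amplification[OF P(1)] this]
    show "commutant (commutant (normalizer (oper ` amplification M') (oper ` amplification N)))
        = oper ` amplification M'"
      unfolding normalizer_oper commutant_oper N_def amplification_relative_commutant[OF vN P(1)] by simp
  qed
  ultimately show ?thesis
    using sub vn_tensor_bounded_ops[of N] vn_tensor_bounded_ops[of M'] vN_one[OF N] closed(1)
    unfolding M' amplification_def by (intro exI[of _ "oper ` N"]) simp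
qed

end
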